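(* Let $(X,d)$ be a complete (proper geodesic) Busemann concave metric space admitting a non-trivial Hausdorff measure, i.e. there is $n\in[0,\infty)$ such that the $n$-dimensional Hausdorff measure satisfies $0<\mathcal{H}^n(B_r(x))<\infty$ for some $x\in X$ and $r>0$. Then $(X,d,\mathcal{H}^n)$ satisfies the measure contraction property $MCP(0,n)$, the Bishop-Gromov volume comparison $BG(0,n)$, and a (weak) $(1,1)$-Poincaré inequality. In particular, $\mathcal{H}^n$ is a doubling measure with doubling constant $2^n$, i.e. $\mathcal{H}^n(B_{2r}(x))\le 2^n\mathcal{H}^n(B_r(x))$ for all $x\in X$, $r>0$.
   Context: A metric space is proper if closed bounded subsets are compact. A geodesic from $x$ to $y$ is a map $\gamma:[0,1]\to X$ with $\gamma(0)=x$, $\gamma(1)=y$ and $d(\gamma(t),\gamma(s))=|t-s|\,d(x,y)$; $X$ is geodesic if any two points are joined by a geodesic. A geodesic space $(X,d)$ is Busemann concave if for all $x,y_1,y_2\in X$ and all geodesics $\gamma_i$ from $x$ to $y_i$ ($i=1,2$) the function $t\mapsto d(\gamma_1(t),\gamma_2(t))$ is concave on $[0,1]$. $\mathcal{H}^n(S)=\lim_{\delta\to0}C_n\inf\{\sum_{i\in\mathbb{N}}(\tfrac12\operatorname{diam}U_i)^n : S\subset\bigcup_i U_i,\ \operatorname{diam}U_i<\delta\}$ with a normalizing constant $C_n>0$. $MCP(0,n)$ for $(X,d,m)$ (in the sense of Ohta): for every $x\in X$ and every measurable $A\subset X$ with $0<m(A)<\infty$ there is a probability measure $\Pi$ on the space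 of geodesics $[0,1]\to X$ such that, with $e_t(\gamma)=\gamma(t)$, $(e_0)_*\Pi=\delta_x$, $(e_1)_*\Pi=m(A)^{-1}m|_A$ and $m\ge (e_t)_*\big(t^n m(A)\,\Pi\big)$ as measures for every $t\in[0,1]$. $BG(0,n)$: $\dfrac{m(B_R(x))}{m(B_r(x))}\le\dfrac{R^n}{r^n}$ for all $x\in X$ and $0<r<R$. Weak $(1,1)$-Poincaré inequality: there are constants $C>0$, $\lambda\ge1$ such that for every ball $B_r(x)$, every locally integrable $u$ and every weak upper gradient $g_u$ of $u$, $$\frac{1}{m(B_r(x))}\int_{B_r(x)}|u-u_{B_r(x)}|\,dm\le C\,r\,\frac{1}{m(B_{\lambda r}(x))}\int_{B_{\lambda r}(x)}g_u\,dm,$$ where $u_B=\frac1{m(B)}\int_B u\,dm$. *)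

theory Defs
  imports "HOL-Probability.Probability"
begin

section \<open>Proper, geodesic and Busemann concave spaces\<close>

definition proper_space :: "'a::metric_space itself \<Rightarrow> bool" where
  "proper_space _ \<longleftrightarrow> (\<forall>S::'a set. closed S \<and> bounded S \<longrightarrow> compact S)"

text \<open>Curves on \<open>[0,1]\<close> are functions on all reals; only their values on \<open>[0,1]\<close> matter.\<close>

definition geodesic :: "(real \<Rightarrow> 'a::metric_space) \<Rightarrow> 'a \<Rightarrow> 'a \<Rightarrow> bool" where
  "geodesic \<gamma> x y \<longleftrightarrow> \<gamma> 0 = x \<and> \<gamma> 1 = y \<and>
     (\<forall>s\<in>{0..1}. \<forall>t\<in>{0..1}. dist (\<gamma> t) (\<gamma> s) = \<bar>t - s\<bar> * dist x y)"

definition geodesic_space :: "'a::metric_space itself \<Rightarrow> bool" where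
  "geodesic_space _ \<longleftrightarrow> (\<forall>x y::'a. \<exists>\<gamma>. geodesic \<gamma> x y)"

definition busemann_concave :: "'a::metric_space itself \<Rightarrow> bool" where
  "busemann_concave T \<longleftrightarrow> geodesic_space T \<and>
     (\<forall>(x::'a) y1 y2 \<gamma>1 \<gamma>2. geodesic \<gamma>1 x y1 \<and> geodesic \<gamma>2 x y2 \<longrightarrow>
        concave_on {0..1} (\<lambda>t. dist (\<gamma>1 t) (\<gamma>2 t)))"


section \<open>Hausdorff measure\<close>

text \<open>Real powers of nonnegative numbers with \<open>0\<^sup>0 = 1\<close> (whereas \<open>0 powr 0 = 0\<close>).\<close>

definition rpow :: "real \<Rightarrow> real \<Rightarrow> real" where
  "rpow t n = (if n = 0 then 1 else t powr n)"

text \<open>The empty set contributes \<open>0\<close> to a cover, also for \<open>n = 0\<close>, so that finite covers are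
  among the countable ones and the 0-dimensional measure is a multiple of counting measure.\<close>

definition hausdorff_term :: "real \<Rightarrow> 'a::metric_space set \<Rightarrow> ennreal" where
  "hausdorff_term n U = (if U = {} then 0 else ennreal (rpow (diameter U / 2) n))"

text \<open>\<^const>\<open>diameter\<close> is meaningful only on bounded sets.\<close>

definition hausdorff_covers :: "real \<Rightarrow> 'a::metric_space set \<Rightarrow> (nat \<Rightarrow> 'a set) set" where
  "hausdorff_covers \<delta> S =
     {U. S \<subseteq> (\<Union>i. U i) \<and> (\<forall>i. bounded (U i) \<and> diameter (U i) < \<delta>)}"

definition hausdorff_content :: "real \<Rightarrow> real \<Rightarrow> real \<Rightarrow> 'a::metric_space set \<Rightarrow> ennreal" where
  "hausdorff_content c n \<delta> S =
     ennreal c * (INF U \<in> hausdorff_covers \<delta> S. \<Sum>i. hausdorff_term n (U i))"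

definition hausdorff_outer :: "real \<Rightarrow> real \<Rightarrow> 'a::metric_space set \<Rightarrow> ennreal" where
  "hausdorff_outer c n S = Lim (at_right 0) (\<lambda>\<delta>. hausdorff_content c n \<delta> S)"

text \<open>The \<open>n\<close>-dimensional Hausdorff measure with normalizing constant \<open>c\<close>, as a measure on the
  Borel sets. The lemma \<open>emeasure_hausdorff_measure\<close> below shows that it agrees there with
  \<^const>\<open>hausdorff_outer\<close>.\<close>

definition hausdorff_measure :: "real \<Rightarrow> real \<Rightarrow> 'a::metric_space measure" where
  "hausdorff_measure c n = measure_of UNIV (sets borel) (hausdorff_outer c n)"


section \<open>Measure contraction and Bishop--Gromov\<close>

text \<open>Geodesics are made extensional, so that they are determined by their values on
  \<open>[0,1]\<close>; the \<open>\<sigma>\<close>-algebra is the Borel \<open>\<sigma>\<close>-algebra of the uniform distance.\<close>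

definition geodesics :: "(real \<Rightarrow> 'a::metric_space) set" where
  "geodesics = {\<gamma> \<in> extensional {0..1}. \<exists>x y. geodesic \<gamma> x y}"

definition geodesics_metric :: "(real \<Rightarrow> 'a::metric_space) metric" where
  "geodesics_metric = submetric (funspace {0..1} euclidean_metric) geodesics"

definition geodesics_borel :: "(real \<Rightarrow> 'a::metric_space) measure" where
  "geodesics_borel = sigma geodesics {U. openin (mtopology_of geodesics_metric) U}"

definition MCP0 :: "real \<Rightarrow> 'a::metric_space measure \<Rightarrow> bool" where
  "MCP0 n m \<longleftrightarrow>
     (\<forall>x. \<forall>A\<in>sets m. 0 < emeasure m A \<and> emeasure m A < \<infinity> \<longrightarrow>
       (\<exists>Q :: (real \<Rightarrow> 'a) measure. sets Q = sets geodesics_borel \<and> prob_space Q \<and>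
          distr Q borel (\<lambda>\<gamma>. \<gamma> 0) = return borel x \<and>
          distr Q borel (\<lambda>\<gamma>. \<gamma> 1) = uniform_measure m A \<and>
          (\<forall>t\<in>{0..1}.
             distr (scale_measure (ennreal (rpow t n) * emeasure m A) Q) borel (\<lambda>\<gamma>. \<gamma> t) \<le> m)))"

text \<open>The quotient of volumes makes sense only if balls have positive finite measure; this is
  required explicitly because division on \<^typ>\<open>ennreal\<close> is total.\<close>

definition BG0 :: "real \<Rightarrow> 'a::metric_space measure \<Rightarrow> bool" where
  "BG0 n m \<longleftrightarrow>
     (\<forall>x r. 0 < r \<longrightarrow> 0 < emeasure m (ball x r) \<and> emeasure m (ball x r) < \<infinity>) \<and>
     (\<forall>x r R. 0 < r \<and> r < R \<longrightarrow>
        emeasure m (ball x R) / emeasure m (ball x r) \<le> ennreal (rpow R n / rpow r n))"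


section \<open>Curves, weak upper gradients and the Poincare inequality\<close>

definition curve_length :: "(real \<Rightarrow> 'a::metric_space) \<Rightarrow> real \<Rightarrow> real \<Rightarrow> ennreal" where
  "curve_length \<gamma> a b =
     (SUP (p, N) \<in> {(p::nat \<Rightarrow> real, N::nat). mono p \<and> range p \<subseteq> {a..b}}.
        \<Sum>i<N. ennreal (dist (\<gamma> (p i)) (\<gamma> (p (Suc i)))))"

definition rectifiable :: "(real \<Rightarrow> 'a::metric_space) \<Rightarrow> bool" where
  "rectifiable \<gamma> \<longleftrightarrow> continuous_on {0..1} \<gamma> \<and> curve_length \<gamma> 0 1 < \<infinity>"

text \<open>The arc length parametrization: the point of \<open>\<gamma>\<close> reached after length \<open>s\<close>. It does not
  depend on the choice of \<open>t\<close>, since \<open>\<gamma>\<close> is constant where the length does not grow.\<close>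

definition arclength_param :: "(real \<Rightarrow> 'a::metric_space) \<Rightarrow> real \<Rightarrow> 'a" where
  "arclength_param \<gamma> s = \<gamma> (SOME t. t \<in> {0..1} \<and> curve_length \<gamma> 0 t = ennreal s)"

definition curve_integral :: "(real \<Rightarrow> 'a::metric_space) \<Rightarrow> ('a \<Rightarrow> ennreal) \<Rightarrow> ennreal" where
  "curve_integral \<gamma> g =
     (\<integral>\<^sup>+s\<in>{0..enn2real (curve_length \<gamma> 0 1)}. g (arclength_param \<gamma> s) \<partial>lborel)"

text \<open>The 1-modulus of a family of rectifiable curves, and 1-weak upper gradients. As
  families that are \<open>p\<close>-exceptional are locally 1-exceptional, this is the largest of the usual
  classes of weak upper gradients.\<close>

definition modulus1 :: "'a::metric_space measure \<Rightarrow> (real \<Rightarrow> 'a) set \<Rightarrow> ennreal" where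
  "modulus1 m \<Gamma> =
     (INF \<rho> \<in> {\<rho> \<in> borel_measurable borel. \<forall>\<gamma>\<in>\<Gamma>. 1 \<le> curve_integral \<gamma> \<rho>}. \<integral>\<^sup>+x. \<rho> x \<partial>m)"

definition weak_upper_gradient ::
  "'a::metric_space measure \<Rightarrow> ('a \<Rightarrow> real) \<Rightarrow> ('a \<Rightarrow> ennreal) \<Rightarrow> bool" where
  "weak_upper_gradient m u g \<longleftrightarrow> g \<in> borel_measurable borel \<and>
     modulus1 m {\<gamma>. rectifiable \<gamma> \<and> \<not> ennreal \<bar>u (\<gamma> 0) - u (\<gamma> 1)\<bar> \<le> curve_integral \<gamma> g} = 0"

definition locally_integrable :: "'a::metric_space measure \<Rightarrow> ('a \<Rightarrow> real) \<Rightarrow> bool" where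
  "locally_integrable m u \<longleftrightarrow> u \<in> borel_measurable m \<and>
     (\<forall>x. \<exists>r>0. set_integrable m (ball x r) u)"

definition average :: "'a::metric_space measure \<Rightarrow> 'a set \<Rightarrow> ('a \<Rightarrow> real) \<Rightarrow> real" where
  "average m B u = set_lebesgue_integral m B u / measure m B"

text \<open>The completion admits all \<open>m\<close>-measurable functions \<open>u\<close>, not only Borel ones.\<close>

definition poincare11 :: "'a::metric_space measure \<Rightarrow> bool" where
  "poincare11 m \<longleftrightarrow>
     (\<exists>C>0. \<exists>\<Lambda>\<ge>1. \<forall>x. \<forall>r>0. \<forall>u g.
        locally_integrable (completion m) u \<and> weak_upper_gradient m u g \<longrightarrow>
        (\<integral>\<^sup>+y\<in>ball x r. ennreal \<bar>u y - average (completion m) (ball x r) u\<bar> \<partial>completion m)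
            / emeasure m (ball x r)
          \<le> ennreal (C * r) *
            ((\<integral>\<^sup>+y\<in>ball x (\<Lambda> * r). g y \<partial>m) / emeasure m (ball x (\<Lambda> * r))))"


section \<open>The Hausdorff measure extends the Hausdorff outer measure\<close>

lemma hausdorff_content_antimono:
  assumes "\<delta> \<le> \<epsilon>"
  shows "hausdorff_content c n \<epsilon> S \<le> hausdorff_content c n \<delta> S"
  unfolding hausdorff_content_def hausdorff_covers_def
  by (intro mult_left_mono INF_superset_mono) (use assms in \<open>auto intro: less_le_trans\<close>)

lemma tendsto_SUP_at_right_0:
  fixes f :: "real \<Rightarrow> ennreal"
  assumes anti: "\<And>\<delta> \<epsilon>. \<delta> \<le> \<epsilon> \<Longrightarrow> f \<epsilon> \<le> f \<delta>"
  shows "(f \<longlongrightarrow> (SUP \<delta>\<in>{0<..}. f \<delta>)) (at_right 0)"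
proof (rule order_tendstoI)
  fix a assume "a < (SUP \<delta>\<in>{0<..}. f \<delta>)"
  then obtain d where d: "d > 0" "a < f d" by (auto simp: less_SUP_iff)
  have "\<forall>\<^sub>F \<delta> in at_right 0. \<delta> < d"
    using d(1) eventually_at_right_field by auto
  then show "\<forall>\<^sub>F \<delta> in at_right 0. a < f \<delta>"
    by eventually_elim (use d anti in \<open>auto intro: less_le_trans\<close>)
next
  fix a assume a: "(SUP \<delta>\<in>{0<..}. f \<delta>) < a"
  have "\<forall>\<^sub>F \<delta>::real in at_right 0. 0 < \<delta>"
    by (simp add: eventually_at_right_less)
  then show "\<forall>\<^sub>F \<delta> in at_right 0. f \<delta> < a"
    by eventually_elim (use a in \<open>auto intro: le_less_trans[OF SUP_upper]\<close>)
qed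

lemma hausdorff_outer_tendsto:
  "((\<lambda>\<delta>. hausdorff_content c n \<delta> S) \<longlongrightarrow> hausdorff_outer c n S) (at_right 0)"
  and hausdorff_outer_SUP:
  "hausdorff_outer c n S = (SUP \<delta>\<in>{0<..}. hausdorff_content c n \<delta> S)"
proof -
  have *: "((\<lambda>\<delta>. hausdorff_content c n \<delta> S) \<longlongrightarrow> (SUP \<delta>\<in>{0<..}. hausdorff_content c n \<delta> S))
      (at_right 0)"
    by (rule tendsto_SUP_at_right_0) (rule hausdorff_content_antimono)
  then show "hausdorff_outer c n S = (SUP \<delta>\<in>{0<..}. hausdorff_content c n \<delta> S)"
    unfolding hausdorff_outer_def by (intro tendsto_Lim) auto
  with * show "((\<lambda>\<delta>. hausdorff_content c n \<delta> S) \<longlongrightarrow> hausdorff_outer c n S) (at_right 0)"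
    by simp
qed

lemma hausdorff_content_le_outer: "0 < \<delta> \<Longrightarrow> hausdorff_content c n \<delta> S \<le> hausdorff_outer c n S"
  unfolding hausdorff_outer_SUP by (rule SUP_upper) simp

lemma hausdorff_content_mono: "S \<subseteq> T \<Longrightarrow> hausdorff_content c n \<delta> S \<le> hausdorff_content c n \<delta> T"
  unfolding hausdorff_content_def hausdorff_covers_def
  by (intro mult_left_mono INF_superset_mono) auto

lemma hausdorff_outer_mono: "S \<subseteq> T \<Longrightarrow> hausdorff_outer c n S \<le> hausdorff_outer c n T"
  unfolding hausdorff_outer_SUP by (rule SUP_mono) (auto intro: hausdorff_content_mono)

lemma hausdorff_content_empty: "0 < \<delta> \<Longrightarrow> hausdorff_content c n \<delta> ({} :: 'a::metric_space set) = 0"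
proof -
  assume "0 < \<delta>"
  then have "(\<lambda>_. {}) \<in> hausdorff_covers \<delta> ({} :: 'a set)"
    by (simp add: hausdorff_covers_def diameter_def)
  then have "(INF U \<in> hausdorff_covers \<delta> ({} :: 'a set). \<Sum>i. hausdorff_term n (U i))
      \<le> (\<Sum>i::nat. hausdorff_term n ({} :: 'a set))"
    by (rule INF_lower2) simp
  then show ?thesis
    by (simp add: hausdorff_content_def hausdorff_term_def)
qed

lemma hausdorff_outer_empty: "hausdorff_outer c n {} = 0"
  unfolding hausdorff_outer_SUP by (simp add: hausdorff_content_empty)

lemma hausdorff_content_subadditive:
  fixes A :: "nat \<Rightarrow> 'a::metric_space set"
  shows "hausdorff_content c n \<delta> (\<Union>i. A i) \<le> (\<Sum>i. hausdorff_content c n \<delta> (A i))"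
proof -
  let ?I = "\<lambda>S::'a set. INF U \<in> hausdorff_covers \<delta> S. \<Sum>i. hausdorff_term n (U i)"
  have "?I (\<Union>i. A i) \<le> (\<Sum>i. ?I (A i))"
  proof (rule ennreal_le_epsilon)
    fix e :: real assume e: "0 < e" and fin: "(\<Sum>i. ?I (A i)) < top"
    have "h < h + ennreal (e * (1/2)^Suc k)" if "h < top" for h k
      using that e by (cases h) (auto simp: ennreal_plus[symmetric] ennreal_less_iff simp del: ennreal_plus)
    then have "?I (A k) < ?I (A k) + e * (1/2)^Suc k" for k
      using ennreal_suminf_lessD[OF fin] by blast
    then have "\<exists>U\<in>hausdorff_covers \<delta> (A k).
        (\<Sum>i. hausdorff_term n (U i)) < ?I (A k) + e * (1/2)^Suc k" for k
      by (simp only: INF_less_iff)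
    then obtain B where B: "\<And>k. B k \<in> hausdorff_covers \<delta> (A k)"
      and Ble: "\<And>k. (\<Sum>i. hausdorff_term n (B k i)) < ?I (A k) + e * (1/2)^Suc k"
      by metis
    define D where "D = case_prod B o prod_decode"
    have "(\<Union>i. A i) \<subseteq> (\<Union>i. D i)"
    proof safe
      fix x k assume "x \<in> A k"
      then obtain j where "x \<in> B k j"
        using B[of k] by (auto simp: hausdorff_covers_def)
      then have "x \<in> D (prod_encode (k, j))" by (simp add: D_def)
      then show "x \<in> (\<Union>i. D i)" by blast
    qed
    then have "D \<in> hausdorff_covers \<delta> (\<Union>i. A i)"
      using B by (auto simp: hausdorff_covers_def D_def split_def)
    then have "?I (\<Union>i. A i) \<le> (\<Sum>i. hausdorff_term n (D i))"
      by (rule INF_lower)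
    also have "\<dots> = (\<Sum>k. \<Sum>i. hausdorff_term n (B k i))"
      using suminf_ennreal_2dimen[of "\<lambda>k. \<Sum>i. hausdorff_term n (B k i)"
          "\<lambda>(k, i). hausdorff_term n (B k i)"]
      by (simp add: D_def split_def)
    also have "\<dots> \<le> (\<Sum>k. ?I (A k) + e * (1/2)^Suc k)"
      by (intro suminf_le allI less_imp_le[OF Ble]) auto
    also have "\<dots> = (\<Sum>k. ?I (A k)) + (\<Sum>k. ennreal e * ennreal ((1/2) ^ Suc k))"
      using e by (subst suminf_add[symmetric])
        (auto simp del: ennreal_suminf_cmult simp add: ennreal_mult[symmetric])
    also have "\<dots> = (\<Sum>k. ?I (A k)) + e"
      unfolding ennreal_suminf_cmult
      by (subst suminf_ennreal_eq[OF zero_le_power power_half_series]) auto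
    finally show "?I (\<Union>i. A i) \<le> (\<Sum>k. ?I (A k)) + e" .
  qed
  then have "ennreal c * ?I (\<Union>i. A i) \<le> ennreal c * (\<Sum>i. ?I (A i))"
    by (rule mult_left_mono) simp
  then show ?thesis by (simp add: hausdorff_content_def)
qed

lemma hausdorff_outer_subadditive:
  "hausdorff_outer c n (\<Union>i::nat. A i) \<le> (\<Sum>i. hausdorff_outer c n (A i))"
proof -
  have "hausdorff_content c n \<delta> (\<Union>i. A i) \<le> (\<Sum>i. hausdorff_outer c n (A i))" if "0 < \<delta>" for \<delta>
    using hausdorff_content_subadditive[of c n \<delta> A]
    by (rule order_trans) (intro suminf_le hausdorff_content_le_outer that allI; simp)
  then show ?thesis
    unfolding hausdorff_outer_SUP[of c n "\<Union>i. A i"] by (intro SUP_least) auto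
qed

lemma outer_measure_space_hausdorff_outer:
  "outer_measure_space (Pow UNIV) (hausdorff_outer c n)"
  by (auto simp: outer_measure_space_def positive_def increasing_def countably_subadditive_def
      hausdorff_outer_empty hausdorff_outer_mono hausdorff_outer_subadditive)

lemma hausdorff_outer_Un_le:
  "hausdorff_outer c n (A \<union> B) \<le> hausdorff_outer c n A + hausdorff_outer c n B"
proof -
  have "hausdorff_outer c n (\<Union>i. binaryset A B i)
      \<le> (\<Sum>i. hausdorff_outer c n (binaryset A B i))"
    by (rule hausdorff_outer_subadditive)
  also have "(\<Sum>i. hausdorff_outer c n (binaryset A B i))
      = hausdorff_outer c n A + hausdorff_outer c n B"
    using suminf_binaryset_eq[of "hausdorff_outer c n" A B] by (simp add: hausdorff_outer_empty)
  finally show ?thesis by (simp add: UN_binaryset_eq)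
qed

lemma hausdorff_content_separated:
  fixes A B :: "'a::metric_space set"
  assumes "\<delta> \<le> \<epsilon>" "\<And>x y. x \<in> A \<Longrightarrow> y \<in> B \<Longrightarrow> \<epsilon> \<le> dist x y"
  shows "hausdorff_content c n \<delta> A + hausdorff_content c n \<delta> B \<le> hausdorff_content c n \<delta> (A \<union> B)"
proof -
  let ?I = "\<lambda>S::'a set. INF U \<in> hausdorff_covers \<delta> S. \<Sum>i. hausdorff_term n (U i)"
  have "?I A + ?I B \<le> ?I (A \<union> B)"
  proof (rule INF_greatest)
    fix U assume U: "U \<in> hausdorff_covers \<delta> (A \<union> B)"
    have \<delta>: "0 < \<delta>"
      using U by (auto simp: hausdorff_covers_def intro: le_less_trans[OF diameter_ge_0])
    define V where "V = (\<lambda>S i. if U i \<inter> S = {} then {} else U i)"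
    have V: "V S \<in> hausdorff_covers \<delta> S" if "S \<subseteq> A \<union> B" for S
    proof -
      have "x \<in> (\<Union>i. V S i)" if x: "x \<in> S" for x
      proof -
        obtain i where "x \<in> U i"
          using U x \<open>S \<subseteq> A \<union> B\<close> unfolding hausdorff_covers_def by blast
        with x have "x \<in> V S i" by (auto simp: V_def)
        then show ?thesis by blast
      qed
      moreover have "bounded (V S i) \<and> diameter (V S i) < \<delta>" for i
        using U \<delta> by (simp add: V_def hausdorff_covers_def diameter_def[of "{}"])
      ultimately show ?thesis by (auto simp: hausdorff_covers_def)
    qed
    have "V A i = {} \<or> V B i = {}" for i
    proof (rule ccontr)
      assume "\<not> ?thesis"
      then obtain x y where xy: "x \<in> U i" "x \<in> A" "y \<in> U i" "y \<in> B"
        by (auto simp: V_def split: if_splits)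
      have "\<epsilon> \<le> dist x y" using assms(2) xy by blast
      also have "\<dots> \<le> diameter (U i)"
        using U xy by (intro diameter_bounded_bound) (auto simp: hausdorff_covers_def)
      finally have "\<epsilon> \<le> diameter (U i)" .
      moreover have "diameter (U i) < \<delta>" using U by (auto simp: hausdorff_covers_def)
      ultimately show False using assms(1) by simp
    qed
    note disj = this
    have le: "hausdorff_term n (V A i) + hausdorff_term n (V B i) \<le> hausdorff_term n (U i)" for i
    proof -
      have "hausdorff_term n ({} :: 'a set) = 0" by (simp add: hausdorff_term_def)
      moreover have "V S i = {} \<or> V S i = U i" for S by (simp add: V_def)
      ultimately show ?thesis using disj[of i]
        by (metis add.left_neutral add.right_neutral order_refl zero_le)
    qed
    have "?I A + ?I B \<le> (\<Sum>i. hausdorff_term n (V A i)) + (\<Sum>i. hausdorff_term n (V B i))"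
      by (intro add_mono INF_lower V) auto
    also have "\<dots> = (\<Sum>i. hausdorff_term n (V A i) + hausdorff_term n (V B i))"
      by (rule suminf_add) auto
    also have "\<dots> \<le> (\<Sum>i. hausdorff_term n (U i))"
      by (intro suminf_le allI le) auto
    finally show "?I A + ?I B \<le> (\<Sum>i. hausdorff_term n (U i))" .
  qed
  then have "ennreal c * (?I A + ?I B) \<le> ennreal c * ?I (A \<union> B)"
    by (rule mult_left_mono) simp
  then show ?thesis by (simp add: hausdorff_content_def distrib_left)
qed

lemma hausdorff_outer_separated:
  assumes "0 < \<epsilon>" "\<And>x y. x \<in> A \<Longrightarrow> y \<in> B \<Longrightarrow> \<epsilon> \<le> dist x y"
  shows "hausdorff_outer c n (A \<union> B) = hausdorff_outer c n A + hausdorff_outer c n B"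
proof (rule antisym[OF hausdorff_outer_Un_le])
  have ev: "\<forall>\<^sub>F \<delta> in at_right 0. hausdorff_content c n \<delta> A + hausdorff_content c n \<delta> B
      \<le> hausdorff_content c n \<delta> (A \<union> B)"
    unfolding eventually_at_right_field
    using assms by (intro exI[of _ \<epsilon>]) (auto intro!: hausdorff_content_separated[of _ \<epsilon>])
  show "hausdorff_outer c n A + hausdorff_outer c n B \<le> hausdorff_outer c n (A \<union> B)"
    by (rule tendsto_le[OF _ hausdorff_outer_tendsto
          tendsto_add[OF hausdorff_outer_tendsto hausdorff_outer_tendsto] ev]) simp
qed

lemma hausdorff_outer_layers:
  fixes R :: "nat \<Rightarrow> 'a::metric_space set"
  assumes sub: "\<And>j. R j \<subseteq> T"
    and sep: "\<And>i j. i < j \<Longrightarrow> \<exists>\<epsilon>>0. \<forall>x\<in>R i. \<forall>y\<in>R j. \<epsilon> \<le> dist x y"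
  shows "(\<Sum>j. hausdorff_outer c n (R j)) \<le> hausdorff_outer c n T"
proof -
  have fin: "(\<Sum>j<N. hausdorff_outer c n (R j)) = hausdorff_outer c n (\<Union>j<N. R j)" for N
  proof (induction N)
    case (Suc N)
    have "\<forall>i. \<exists>\<epsilon>. i < N \<longrightarrow> 0 < \<epsilon> \<and> (\<forall>x\<in>R i. \<forall>y\<in>R N. \<epsilon> \<le> dist x y)"
      using sep by meson
    then obtain \<epsilon> where \<epsilon>: "\<And>i. i < N \<Longrightarrow> \<epsilon> i > 0 \<and> (\<forall>x\<in>R i. \<forall>y\<in>R N. \<epsilon> i \<le> dist x y)"
      by metis
    define e where "e = Min (insert 1 (\<epsilon> ` {..<N}))"
    have e: "e > 0" using \<epsilon> by (auto simp: e_def)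
    have "e \<le> \<epsilon> i" if "i < N" for i using that by (auto simp: e_def)
    then have "hausdorff_outer c n ((\<Union>j<N. R j) \<union> R N)
        = hausdorff_outer c n (\<Union>j<N. R j) + hausdorff_outer c n (R N)"
      using \<epsilon> by (intro hausdorff_outer_separated[OF e]) fastforce
    with Suc show ?case by (simp add: lessThan_Suc Un_commute add.commute)
  qed (simp add: hausdorff_outer_empty)
  show ?thesis
    by (rule suminf_le_const) (auto simp: fin intro!: hausdorff_outer_mono dest: sub[THEN subsetD])
qed

lemma suminf_tail_tendsto_0_ennreal:
  fixes f :: "nat \<Rightarrow> ennreal"
  assumes "suminf f < top"
  shows "(\<lambda>k. \<Sum>j. f (j + k)) \<longlonglongrightarrow> 0"
proof -
  have "(\<lambda>k. suminf f - (\<Sum>j<k. f j)) \<longlonglongrightarrow> suminf f - suminf f"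
    using assms by (intro tendsto_diff_ennreal tendsto_const summable_LIMSEQ) (auto simp: less_top)
  moreover have "suminf f - (\<Sum>j<k. f j) = (\<Sum>j. f (j + k))" for k
  proof -
    have "suminf f = (\<Sum>j<k. f j) + (\<Sum>j. f (j + k))"
      by (metis add.commute suminf_offset summableI)
    moreover have "(\<Sum>j<k. f j) < top"
      using assms by (metis le_less_trans sum_le_suminf finite_lessThan summableI zero_le)
    ultimately show ?thesis
      by (metis ennreal_add_diff_cancel_left less_irrefl)
  qed
  ultimately show ?thesis using assms by simp
qed

lemma closed_lambda_system_hausdorff_outer:
  fixes F :: "'a::metric_space set"
  assumes F: "closed F"
  shows "F \<in> lambda_system UNIV (Pow UNIV) (hausdorff_outer c n)"
proof -
  let ?H = "hausdorff_outer c n :: 'a set \<Rightarrow> ennreal"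
  have ge: "?H (T \<inter> F) + ?H (T - F) \<le> ?H T" for T
  proof (cases "F = {} \<or> ?H T = top")
    case True
    then show ?thesis by (auto simp: hausdorff_outer_empty)
  next
    case False
    then have ne: "F \<noteq> {}" and Tfin: "?H T < top" by (auto simp: less_top)
    define a where "a = (\<lambda>k::nat. 1 / real (Suc k))"
    have a_pos: "a k > 0" for k by (simp add: a_def)
    have a_less: "a j < a i" if "i < j" for i j using that by (simp add: a_def field_simps)
    have a_le: "a j \<le> a i" if "i \<le> j" for i j using that by (simp add: a_def field_simps)
    define S where "S = (\<lambda>k. {x\<in>T. a k \<le> infdist x F})"
    define R where "R = (\<lambda>j. {x\<in>T. a (Suc j) \<le> infdist x F \<and> infdist x F < a j})"
    have R_sep: "\<exists>\<epsilon>>0. \<forall>x\<in>R i. \<forall>y\<in>R j. \<epsilon> \<le> dist x y" if "Suc i < j" for i j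
    proof (intro exI conjI ballI)
      show "0 < a (Suc i) - a j" using a_less[OF that] by simp
      fix x y assume "x \<in> R i" "y \<in> R j"
      then show "a (Suc i) - a j \<le> dist x y"
        using infdist_triangle[of x F y] by (auto simp: R_def)
    qed
    have half: "(\<Sum>j. ?H (R (2 * j + p))) \<le> ?H T" for p
    proof (rule hausdorff_outer_layers)
      show "\<exists>\<epsilon>>0. \<forall>x\<in>R (2 * i + p). \<forall>y\<in>R (2 * j + p). \<epsilon> \<le> dist x y" if "i < j" for i j
        by (rule R_sep) (use that in simp)
    qed (auto simp: R_def)
    have "(\<Sum>j. ?H (R j)) \<le> ?H T + ?H T"
    proof (rule suminf_le_const)
      fix N
      have "(\<Sum>j<N. ?H (R j)) \<le> (\<Sum>j<2*N. ?H (R j))"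
        by (rule sum_mono2) auto
      also have "\<dots> = (\<Sum>j<N. ?H (R (2*j+0))) + (\<Sum>j<N. ?H (R (2*j+1)))"
        by (induction N) (simp_all add: algebra_simps)
      also have "\<dots> \<le> ?H T + ?H T"
        by (intro add_mono order_trans[OF sum_le_suminf half]) auto
      finally show "(\<Sum>j<N. ?H (R j)) \<le> ?H T + ?H T" .
    qed auto
    also have "\<dots> < top" using Tfin by (simp add: less_top)
    finally have tail: "(\<lambda>k. \<Sum>j. ?H (R (j + k))) \<longlonglongrightarrow> 0"
      by (rule suminf_tail_tendsto_0_ennreal)
    have main: "?H (T \<inter> F) + ?H (T - F) \<le> ?H T + (\<Sum>j. ?H (R (j + k)))" for k
    proof -
      have "T - F \<subseteq> S k \<union> (\<Union>j. R (j + k))"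
      proof
        fix x assume x: "x \<in> T - F"
        then have pos: "infdist x F > 0"
          using F ne in_closed_iff_infdist_zero[of F x] infdist_nonneg[of x F] by auto
        show "x \<in> S k \<union> (\<Union>j. R (j + k))"
        proof (cases "a k \<le> infdist x F")
          case False
          obtain l where l: "a l < infdist x F"
            using pos reals_Archimedean by (auto simp: a_def inverse_eq_divide)
          define i where "i = (LEAST i. a i \<le> infdist x F)"
          have i: "a i \<le> infdist x F" unfolding i_def by (rule LeastI[of _ l]) (use l in simp)
          have "k < i" using False i a_le[of i k] by (meson not_le order_trans)
          then obtain j where j: "i = Suc (j + k)"
            by (metis add.commute less_imp_Suc_add)
          have "\<not> a (j + k) \<le> infdist x F"
            using not_less_Least[of "j + k" "\<lambda>i. a i \<le> infdist x F"] j by (simp add: i_def)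
          then have "x \<in> R (j + k)" using i j x by (auto simp: R_def)
          then show ?thesis by blast
        qed (use x in \<open>auto simp: S_def\<close>)
      qed
      then have "?H (T - F) \<le> ?H (S k) + ?H (\<Union>j. R (j + k))"
        by (meson hausdorff_outer_Un_le hausdorff_outer_mono order_trans)
      also have "\<dots> \<le> ?H (S k) + (\<Sum>j. ?H (R (j + k)))"
        by (intro add_left_mono hausdorff_outer_subadditive)
      finally have "?H (T \<inter> F) + ?H (T - F) \<le> ?H (T \<inter> F) + ?H (S k) + (\<Sum>j. ?H (R (j + k)))"
        by (simp add: add.assoc add_left_mono)
      also have "?H (T \<inter> F) + ?H (S k) = ?H (T \<inter> F \<union> S k)"
      proof (rule hausdorff_outer_separated[OF a_pos[of k], symmetric])
        fix x y assume "x \<in> T \<inter> F" "y \<in> S k"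
        then show "a k \<le> dist x y"
          using infdist_le[of x F y] by (auto simp: S_def dist_commute)
      qed
      also have "?H (T \<inter> F \<union> S k) \<le> ?H T"
        by (rule hausdorff_outer_mono) (auto simp: S_def)
      finally show ?thesis by (simp add: add_right_mono)
    qed
    have "(\<lambda>k. ?H T + (\<Sum>j. ?H (R (j + k)))) \<longlonglongrightarrow> ?H T + 0"
      by (intro tendsto_add tendsto_const tail)
    then show ?thesis
      using main by (auto intro: LIMSEQ_le_const)
  qed
  have "?H (T \<inter> F) + ?H (T - F) = ?H T" for T
    using ge[of T] hausdorff_outer_Un_le[of c n "T \<inter> F" "T - F"] by (simp add: Int_Diff_Un antisym)
  then show ?thesis
    by (simp add: lambda_system_def Int_commute Diff_eq[symmetric] Compl_eq_Diff_UNIV[symmetric])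
qed

lemma emeasure_hausdorff_measure:
  fixes A :: "'a::metric_space set"
  assumes "A \<in> sets borel"
  shows "emeasure (hausdorff_measure c n) A = hausdorff_outer c n A"
proof -
  let ?L = "lambda_system (UNIV::'a set) (Pow UNIV) (hausdorff_outer c n)"
  interpret P: sigma_algebra "UNIV::'a set" "Pow UNIV" by (rule sigma_algebra_Pow)
  have ms: "measure_space (UNIV::'a set) ?L (hausdorff_outer c n)"
    by (rule P.caratheodory_lemma[OF outer_measure_space_hausdorff_outer])
  have "sets (borel::'a measure) = sigma_sets UNIV {F. closed F}"
    by (simp add: borel_eq_closed)
  also have "\<dots> \<subseteq> ?L"
    using ms closed_lambda_system_hausdorff_outer
    by (intro sigma_algebra.sigma_sets_subset) (auto simp: measure_space_def)
  finally have "measure_space (UNIV::'a set) (sets borel) (hausdorff_outer c n)"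
    using measure_down[OF ms, of "sets borel"] sets.sigma_algebra_axioms[of "borel::'a measure"]
    by simp
  then show ?thesis
    using assms unfolding hausdorff_measure_def
    by (intro emeasure_measure_of_sigma) (auto simp: measure_space_def)
qed

lemma sets_hausdorff_measure [simp]:
  "sets (hausdorff_measure c n :: 'a::metric_space measure) = sets borel"
  and space_hausdorff_measure [simp]: "space (hausdorff_measure c n :: 'a measure) = UNIV"
  using sets.sigma_sets_eq[of "borel :: 'a measure"]
  by (simp_all add: hausdorff_measure_def space_measure_of_conv sets_measure_of_conv)


section \<open>Measurability of evaluation on the space of geodesics\<close>

lemma geodesics_subset_fspace: "geodesics \<subseteq> mspace (funspace {0..1} euclidean_metric)"
proof
  fix \<gamma> :: "real \<Rightarrow> 'a" assume "\<gamma> \<in> geodesics"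
  then obtain x y where \<gamma>: "\<gamma> \<in> extensional {0..1}" "geodesic \<gamma> x y" by (auto simp: geodesics_def)
  have "dist x (\<gamma> t) \<le> dist x y" if "t \<in> {0..1}" for t
  proof -
    have "\<gamma> 0 = x" and "\<forall>s\<in>{0..1}. \<forall>t\<in>{0..1}. dist (\<gamma> t) (\<gamma> s) = \<bar>t - s\<bar> * dist x y"
      using \<gamma>(2) unfolding geodesic_def by blast+
    then have "dist (\<gamma> t) x = \<bar>t - 0\<bar> * dist x y"
      using that by (metis atLeastAtMost_iff order_refl zero_le_one)
    then show ?thesis
      using that by (simp add: dist_commute mult_left_le_one_le)
  qed
  then have "bounded (\<gamma> ` {0..1})" unfolding bounded_def by blast
  then show "\<gamma> \<in> mspace (funspace {0..1} euclidean_metric)"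
    using \<gamma>(1) by (simp add: Met_TC.fspace_def)
qed

lemma mspace_geodesics_metric [simp]: "mspace geodesics_metric = geodesics"
  using geodesics_subset_fspace by (auto simp: geodesics_metric_def)

lemma sets_geodesics_borel:
  "sets geodesics_borel =
     sigma_sets (geodesics :: (real \<Rightarrow> 'a::metric_space) set) {U. openin (mtopology_of geodesics_metric) U}"
  and space_geodesics_borel [simp]: "space geodesics_borel = (geodesics :: (real \<Rightarrow> 'a::metric_space) set)"
proof -
  have "{U. openin (mtopology_of geodesics_metric) U} \<subseteq> Pow (geodesics :: (real \<Rightarrow> 'a) set)"
    using openin_subset[of "mtopology_of (geodesics_metric :: (real \<Rightarrow> 'a) metric)"] by auto
  then show "sets geodesics_borel =
      sigma_sets (geodesics :: (real \<Rightarrow> 'a) set) {U. openin (mtopology_of geodesics_metric) U}"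
    "space geodesics_borel = (geodesics :: (real \<Rightarrow> 'a) set)"
    by (auto simp: geodesics_borel_def)
qed

lemma measurable_eval_geodesics:
  assumes t: "t \<in> {0..1}"
  shows "(\<lambda>\<gamma>. \<gamma> t) \<in> geodesics_borel \<rightarrow>\<^sub>M (borel :: 'a::metric_space measure)"
proof (rule borel_measurableI)
  fix V :: "'a set" assume V: "open V"
  let ?G = "geodesics_metric :: (real \<Rightarrow> 'a) metric"
  let ?U = "{\<gamma> \<in> geodesics. \<gamma> t \<in> V}"
  interpret G: Metric_space geodesics "mdist ?G" using Metric_space_mspace_mdist[of ?G] by simp
  have "openin G.mtopology ?U"
    unfolding G.openin_mtopology
  proof (intro conjI allI impI)
    fix \<gamma> assume \<gamma>: "\<gamma> \<in> ?U"
    then obtain e where e: "e > 0" "\<And>y. dist y (\<gamma> t) < e \<Longrightarrow> y \<in> V"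
      using V by (auto simp: open_dist)
    have "G.mball \<gamma> e \<subseteq> ?U"
    proof
      fix \<eta> assume "\<eta> \<in> G.mball \<gamma> e"
      then have \<eta>: "\<eta> \<in> geodesics" "mdist ?G \<gamma> \<eta> < e" by (auto simp: G.in_mball)
      have "dist (\<gamma> t) (\<eta> t) \<le> mdist (funspace {0..1} euclidean_metric) \<gamma> \<eta>"
        using funspace_mdist_le[of \<gamma> "{0..1}" euclidean_metric \<eta>
            "mdist (funspace {0..1} euclidean_metric) \<gamma> \<eta>"] \<gamma> \<eta> t geodesics_subset_fspace
        by force
      then have "dist (\<eta> t) (\<gamma> t) < e" using \<eta> by (simp add: geodesics_metric_def dist_commute)
      then show "\<eta> \<in> ?U" using e \<eta> by auto
    qed
    with e show "\<exists>r>0. G.mball \<gamma> r \<subseteq> ?U" by blast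
  qed auto
  then have "?U \<in> sets geodesics_borel"
    by (simp add: sets_geodesics_borel mtopology_of_def sigma_sets.Basic)
  then show "(\<lambda>\<gamma>. \<gamma> t) -` V \<inter> space geodesics_borel \<in> sets geodesics_borel"
    by (simp add: vimage_def Int_def conj_commute)
qed

end

(*
In a Busemann concave space, geodesics \<gamma>1, \<gamma>2 issuing from x satisfy
t d(\<gamma>1 1, \<gamma>2 1) \<le> d(\<gamma>1 t, \<gamma>2 t), so moving a set towards x by the factor t decreases its
Hausdorff measure at most by the factor t^n. Applied to balls this gives finiteness and positivity
of balls, Bishop--Gromov and doubling.

A geodesic from x to z that extends beyond z is the only one from x to z. By Bishop--Gromov almost
every z is such a point: the closed set of points at time s < 1 on a geodesic from x contains at
least the fraction s^n of each ball around x. On these points the geodesic from x depends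
continuously on its endpoint, and its law for z uniform in A is the measure required by MCP.

For Poincare, a weak upper gradient is enlarged by a function of small integral which has infinite
integral along all exceptional geodesics. Then |u(y) - u(z)| is bounded by the integral of the
gradient along the geodesic from y to z; one integrates over y, z in the ball and contracts, for
fixed t, towards y if t \<ge> 1/2 and towards z if t < 1/2.
*)

theory Submission
  imports Defs
begin

section \<open>Geodesics in Busemann concave spaces\<close>

text \<open>The inequality t d(\<gamma>1 1, \<gamma>2 1) \<le> d(\<gamma>1 t, \<gamma>2 t) is
  concavity combined with the value 0 at time 0. What shapes the proof is that two points may be
  joined by several geodesics, as antipodal points of a circle are, so that no measurable choice
  among them is evident. The volume estimates evade this, because an estimate of Hausdorff outer
  measure accepts any choice. The measures for MCP and Tonelli's theorem do not: they require a
  Borel set of pairs with unique geodesics whose sections have full measure. Properness makes it a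
  countable union of closed sets and turns uniqueness into continuity.

  The cut at t = 1/2 keeps the contraction factor at least 2^-n; contracting towards one endpoint
  for all t would leave the weight t^-n, which is not integrable near 0 if n \<ge> 1. Giving
  exceptional geodesics an infinite integral makes the gradient bound trivial on them, so that it
  never has to be shown that few pairs of points are joined by one.\<close>

lemma geodesicD:
  assumes "geodesic \<gamma> x y"
  shows "\<gamma> 0 = x" "\<gamma> 1 = y"
    and "\<And>s t. s \<in> {0..1} \<Longrightarrow> t \<in> {0..1} \<Longrightarrow> dist (\<gamma> s) (\<gamma> t) = \<bar>s - t\<bar> * dist x y"
    and "\<And>t. t \<in> {0..1} \<Longrightarrow> dist x (\<gamma> t) = t * dist x y"
    and "\<And>t. t \<in> {0..1} \<Longrightarrow> dist (\<gamma> t) y = (1 - t) * dist x y"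
proof -
  have *: "dist (\<gamma> s) (\<gamma> t) = \<bar>s - t\<bar> * dist x y" if "s \<in> {0..1}" "t \<in> {0..1}" for s t
    using assms that unfolding geodesic_def by blast
  show 1: "\<gamma> 0 = x" "\<gamma> 1 = y" using assms unfolding geodesic_def by blast+
  show "dist (\<gamma> s) (\<gamma> t) = \<bar>s - t\<bar> * dist x y" if "s \<in> {0..1}" "t \<in> {0..1}" for s t
    using * that .
  show "dist x (\<gamma> t) = t * dist x y" if "t \<in> {0..1}" for t
    using *[of 0 t] that 1 by simp
  show "dist (\<gamma> t) y = (1 - t) * dist x y" if "t \<in> {0..1}" for t
    using *[of t 1] that 1 by simp
qed

lemma geodesicI:
  assumes "\<gamma> 0 = x" "\<gamma> 1 = y"
    and "\<And>s t. 0 \<le> s \<Longrightarrow> s \<le> t \<Longrightarrow> t \<le> 1 \<Longrightarrow> dist (\<gamma> s) (\<gamma> t) = (t - s) * dist x y"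
  shows "geodesic \<gamma> x y"
  unfolding geodesic_def
proof (intro conjI assms(1,2) ballI)
  fix s t :: real assume "s \<in> {0..1}" "t \<in> {0..1}"
  then show "dist (\<gamma> t) (\<gamma> s) = \<bar>t - s\<bar> * dist x y"
    using assms(3)[of s t] assms(3)[of t s] by (cases "s \<le> t") (auto simp: dist_commute)
qed

lemma geodesic_reverse:
  assumes "geodesic \<gamma> x y"
  shows "geodesic (\<lambda>t. \<gamma> (1 - t)) y x"
  by (rule geodesicI) (use geodesicD[OF assms] in \<open>simp_all add: dist_commute\<close>)

text \<open>The two distance hypotheses place \<open>w\<close> between \<open>x\<close> and
  \<open>y\<close>. For points on different pieces the triangle inequality via \<open>w\<close>
  gives the upper bound; a smaller distance would make the way from \<open>x\<close> to
  \<open>y\<close> shorter than \<open>dist x y\<close>.\<close>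

lemma geodesic_concat:
  fixes x w y :: "'a::metric_space"
  assumes \<alpha>: "geodesic \<alpha> x w" and \<beta>: "geodesic \<beta> w y"
    and t: "0 < t" "t < 1"
    and d1: "dist x w = t * dist x y" and d2: "dist w y = (1 - t) * dist x y"
  shows "geodesic (\<lambda>u. if u \<le> t then \<alpha> (u / t) else \<beta> ((u - t) / (1 - t))) x y"
    (is "geodesic ?\<gamma> x y")
proof (rule geodesicI)
  have unit: "u / t \<in> {0..1}" if "0 \<le> u" "u \<le> t" for u using that t by simp
  have unit': "(u - t) / (1 - t) \<in> {0..1}" if "t \<le> u" "u \<le> 1" for u using that t by simp
  show "?\<gamma> 0 = x" "?\<gamma> 1 = y" using geodesicD(1)[OF \<alpha>] geodesicD(2)[OF \<beta>] t by auto
  fix u v :: real assume uv: "0 \<le> u" "u \<le> v" "v \<le> 1"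
  consider "v \<le> t" | "t < u" | "u \<le> t" "t < v" using uv by linarith
  then show "dist (?\<gamma> u) (?\<gamma> v) = (v - u) * dist x y"
  proof cases
    case 1
    then have "dist (?\<gamma> u) (?\<gamma> v) = \<bar>u / t - v / t\<bar> * (t * dist x y)"
      using uv geodesicD(3)[OF \<alpha> unit[of u] unit[of v]] d1 by simp
    also have "\<bar>u / t - v / t\<bar> = (v - u) / t"
      using uv t by (simp add: diff_divide_distrib[symmetric])
    finally show ?thesis using t by simp
  next
    case 2
    then have "dist (?\<gamma> u) (?\<gamma> v)
        = \<bar>(u - t) / (1 - t) - (v - t) / (1 - t)\<bar> * ((1 - t) * dist x y)"
      using uv geodesicD(3)[OF \<beta> unit'[of u] unit'[of v]] d2 by simp
    also have "\<bar>(u - t) / (1 - t) - (v - t) / (1 - t)\<bar> = (v - u) / (1 - t)"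
      using uv t by (simp add: diff_divide_distrib[symmetric])
    finally show ?thesis using t by simp
  next
    case 3
    have xu: "dist x (?\<gamma> u) = u * dist x y"
      using geodesicD(4)[OF \<alpha> unit[of u]] uv 3 t d1 by simp
    have uw: "dist (?\<gamma> u) w = (t - u) * dist x y"
      using geodesicD(5)[OF \<alpha> unit[of u]] uv 3 t d1 by (simp add: diff_divide_eq_iff)
    have wv: "dist w (?\<gamma> v) = (v - t) * dist x y"
      using geodesicD(4)[OF \<beta> unit'[of v]] uv 3 t d2 by simp
    have vy: "dist (?\<gamma> v) y = (1 - v) * dist x y"
      using geodesicD(5)[OF \<beta> unit'[of v]] uv 3 t d2 by (simp add: diff_divide_eq_iff)
    have "dist (?\<gamma> u) (?\<gamma> v) \<le> (v - u) * dist x y"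
      using dist_triangle[of "?\<gamma> u" "?\<gamma> v" w] uw wv by (simp add: algebra_simps)
    moreover have "dist x y \<le> dist x (?\<gamma> u) + dist (?\<gamma> u) (?\<gamma> v) + dist (?\<gamma> v) y"
      using dist_triangle[of x y "?\<gamma> v"] dist_triangle[of x "?\<gamma> v" "?\<gamma> u"] by simp
    then have "(v - u) * dist x y \<le> dist (?\<gamma> u) (?\<gamma> v)"
      using xu vy by (simp add: algebra_simps)
    ultimately show ?thesis by simp
  qed
qed

text \<open>Concavity between the times 0 and \<open>s\<close>; the distance is 0 at time 0 since
  both geodesics start at \<open>x\<close>.\<close>

lemma busemann_concave_expand:
  fixes x y1 y2 :: "'a::metric_space"
  assumes "busemann_concave TYPE('a)" "geodesic \<gamma>1 x y1" "geodesic \<gamma>2 x y2"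
    and "s \<in> {0..1}" "t \<in> {0..1}"
  shows "t * dist (\<gamma>1 s) (\<gamma>2 s) \<le> dist (\<gamma>1 (t * s)) (\<gamma>2 (t * s))"
proof -
  have "concave_on {0..1} (\<lambda>t. dist (\<gamma>1 t) (\<gamma>2 t))"
    using assms unfolding busemann_concave_def by blast
  from concave_onD[OF this, of t 0 s] show ?thesis
    using assms geodesicD(1)[OF assms(2)] geodesicD(1)[OF assms(3)] by simp
qed

text \<open>A concave function vanishing at \<open>0\<close>, at an interior point and at \<open>1\<close> vanishes: hence a
  geodesic that can be prolonged beyond its endpoint is unique.\<close>

lemma geodesic_unique_of_prolongation:
  fixes x z y :: "'a::metric_space"
  assumes busemann: "busemann_concave TYPE('a)"
    and \<alpha>: "geodesic \<alpha> x z" and \<beta>: "geodesic \<beta> x z"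
    and s: "0 < s" "s < 1"
    and d1: "dist x z = s * dist x y" and d2: "dist z y = (1 - s) * dist x y"
    and u: "u \<in> {0..1}"
  shows "\<alpha> u = \<beta> u"
proof -
  obtain \<delta> where \<delta>: "geodesic \<delta> z y"
    using busemann unfolding busemann_concave_def geodesic_space_def by blast
  \<comment> \<open>Both geodesics continue along the same \<delta>, so their distance vanishes at
    \<open>s\<close> and at 1.\<close>
  let ?\<alpha> = "\<lambda>u. if u \<le> s then \<alpha> (u / s) else \<delta> ((u - s) / (1 - s))"
  let ?\<beta> = "\<lambda>u. if u \<le> s then \<beta> (u / s) else \<delta> ((u - s) / (1 - s))"
  let ?f = "\<lambda>t. dist (?\<alpha> t) (?\<beta> t)"
  have "geodesic ?\<alpha> x y" "geodesic ?\<beta> x y"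
    using geodesic_concat[OF _ \<delta> s d1 d2] \<alpha> \<beta> by blast+
  then have conc: "concave_on {0..1} ?f"
    using busemann unfolding busemann_concave_def by blast
  have us: "0 \<le> u * s" "u * s \<le> s" "u * s < 1"
    using u s by (auto simp: mult_left_le_one_le intro: le_less_trans[of "u * s" s 1])
  \<comment> \<open>\<open>l\<close> is the weight at 1 that makes \<open>s\<close> a convex
    combination of \<open>u * s\<close> and 1. Since \<open>l < 1\<close>, the value at
    \<open>u * s\<close> enters with positive weight.\<close>
  define l where "l = (s - u * s) / (1 - u * s)"
  have "l * (1 - u * s) = s - u * s" using us by (simp add: l_def)
  then have "(1 - l) * (u * s) + l * 1 = s" by (simp add: algebra_simps)
  moreover have "0 \<le> l" "l < 1" using us s by (simp_all add: l_def)
  ultimately have l: "0 \<le> l" "l < 1" "(1 - l) * (u * s) + l * 1 = s" by auto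
  have "(1 - l) * ?f (u * s) + l * ?f 1 \<le> ?f s"
    using concave_onD[OF conc, of l "u * s" 1] l us s by simp
  also have "?f s = 0"
    using geodesicD(2)[OF \<alpha>] geodesicD(2)[OF \<beta>] s by simp
  finally have "(1 - l) * ?f (u * s) \<le> 0" using l s by simp
  then have "?f (u * s) \<le> 0" using l by (simp add: mult_le_0_iff)
  then show ?thesis using us s by simp
qed

lemma continuous_on_geodesic:
  assumes "geodesic \<gamma> x y"
  shows "continuous_on {0..1} \<gamma>"
proof (rule lipschitz_on_continuous_on[of "dist x y"])
  show "(dist x y)-lipschitz_on {0..1} \<gamma>"
    by (rule lipschitz_onI) (use geodesicD(3)[OF assms] in \<open>auto simp: dist_real_def mult.commute\<close>)
qed

section \<open>Hausdorff measure under expanding maps and separability\<close>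

lemma diameter_leI:
  fixes S :: "'a::metric_space set"
  assumes "0 \<le> D" "\<And>x y. x \<in> S \<Longrightarrow> y \<in> S \<Longrightarrow> dist x y \<le> D"
  shows "diameter S \<le> D"
  using assms by (auto simp: diameter_def intro!: cSUP_least)

lemma rpow_nonneg: "0 \<le> rpow t n"
  by (simp add: rpow_def)

lemma rpow_pos: "0 < t \<Longrightarrow> 0 < rpow t n"
  by (simp add: rpow_def)

lemma rpow_mult: "0 \<le> s \<Longrightarrow> 0 \<le> t \<Longrightarrow> rpow (s * t) n = rpow s n * rpow t n"
  by (simp add: rpow_def powr_mult)

lemma rpow_one [simp]: "rpow 1 n = 1"
  by (simp add: rpow_def)

lemma rpow_mono: "0 \<le> n \<Longrightarrow> 0 \<le> s \<Longrightarrow> s \<le> t \<Longrightarrow> rpow s n \<le> rpow t n"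
  by (simp add: rpow_def powr_mono2)

text \<open>A cover of the image pulls back to a cover of \<open>A\<close> whose diameters are
  larger by at most the factor 1/t. The outer measure is used because \<open>f\<close> need not be
  measurable.\<close>

lemma hausdorff_outer_expand:
  fixes f :: "'a::metric_space \<Rightarrow> 'b::metric_space"
  assumes "0 \<le> n" and t: "0 < t"
    and expand: "\<And>a b. a \<in> A \<Longrightarrow> b \<in> A \<Longrightarrow> t * dist a b \<le> dist (f a) (f b)"
  shows "ennreal (rpow t n) * hausdorff_outer c n A \<le> hausdorff_outer c n (f ` A)"
proof -
  have content: "ennreal (rpow t n) * hausdorff_content c n (\<delta> / t) A \<le> hausdorff_content c n \<delta> (f ` A)" for \<delta>
  proof -
    have "ennreal (rpow t n) * (INF V\<in>hausdorff_covers (\<delta> / t) A. \<Sum>i. hausdorff_term n (V i))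
        \<le> (\<Sum>i. hausdorff_term n (U i))" if U: "U \<in> hausdorff_covers \<delta> (f ` A)" for U
    proof -
      define V where "V i = A \<inter> f -` U i" for i
      have dV: "dist a b \<le> diameter (U i) / t" if "a \<in> V i" "b \<in> V i" for a b i
      proof -
        have "t * dist a b \<le> dist (f a) (f b)" using that by (intro expand) (auto simp: V_def)
        also have "\<dots> \<le> diameter (U i)"
          using that U by (intro diameter_bounded_bound) (auto simp: V_def hausdorff_covers_def)
        finally show ?thesis using t by (simp add: field_simps)
      qed
      have U0: "0 \<le> diameter (U i)" for i
        using U by (auto simp: hausdorff_covers_def diameter_ge_0)
      have diam: "diameter (V i) \<le> diameter (U i) / t" for i
        by (rule diameter_leI) (use U0 t dV in auto)
      have "bounded (V i)" for i
        unfolding bounded_two_points using dV by blast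
      moreover have "diameter (V i) < \<delta> / t" for i
        using diam[of i] U t divide_strict_right_mono[of "diameter (U i)" \<delta> t]
        by (auto simp: hausdorff_covers_def intro: le_less_trans)
      moreover have "A \<subseteq> (\<Union>i. V i)"
        using U by (fastforce simp: hausdorff_covers_def V_def)
      ultimately have "V \<in> hausdorff_covers (\<delta> / t) A"
        by (simp add: hausdorff_covers_def)
      then have "(INF V\<in>hausdorff_covers (\<delta> / t) A. \<Sum>i. hausdorff_term n (V i))
          \<le> (\<Sum>i. hausdorff_term n (V i))"
        by (rule INF_lower)
      then have "ennreal (rpow t n) * (INF V\<in>hausdorff_covers (\<delta> / t) A. \<Sum>i. hausdorff_term n (V i))
          \<le> ennreal (rpow t n) * (\<Sum>i. hausdorff_term n (V i))"
        by (rule mult_left_mono) simp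
      also have "\<dots> = (\<Sum>i. ennreal (rpow t n) * hausdorff_term n (V i))"
        by (rule ennreal_suminf_cmult[symmetric])
      also have "\<dots> \<le> (\<Sum>i. hausdorff_term n (U i))"
      proof (rule suminf_le)
        fix i
        show "ennreal (rpow t n) * hausdorff_term n (V i) \<le> hausdorff_term n (U i)"
        \<comment> \<open>For \<open>n = 0\<close> every nonempty set counts 1, so it matters that
          \<open>U i\<close> is nonempty whenever \<open>V i\<close> is; an empty \<open>V i\<close>
          counts 0.\<close>
        proof (cases "V i = {}")
          case False
          then have "U i \<noteq> {}" by (auto simp: V_def)
          have "0 \<le> diameter (V i)" using \<open>bounded (V i)\<close> by (rule diameter_ge_0)
          moreover have "t * diameter (V i) \<le> diameter (U i)" using diam[of i] t by (simp add: field_simps)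
          ultimately have "rpow (t * (diameter (V i) / 2)) n \<le> rpow (diameter (U i) / 2) n"
            using t \<open>0 \<le> n\<close> by (intro rpow_mono) auto
          moreover have "rpow (t * (diameter (V i) / 2)) n = rpow t n * rpow (diameter (V i) / 2) n"
            using t \<open>0 \<le> diameter (V i)\<close> by (intro rpow_mult) auto
          ultimately show ?thesis
            using False \<open>U i \<noteq> {}\<close> 
            by (simp add: hausdorff_term_def rpow_nonneg ennreal_mult[symmetric])
        qed (simp add: hausdorff_term_def)
      qed auto
      finally show ?thesis .
    qed
    then have "ennreal (rpow t n) * (INF V\<in>hausdorff_covers (\<delta> / t) A. \<Sum>i. hausdorff_term n (V i))
        \<le> (INF U\<in>hausdorff_covers \<delta> (f ` A). \<Sum>i. hausdorff_term n (U i))"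
      by (rule INF_greatest)
    from mult_left_mono[OF this, of "ennreal c"] show ?thesis
      unfolding hausdorff_content_def by (simp add: mult_ac)
  qed
  \<comment> \<open>Scale \<delta> on \<open>A\<close> is compared with scale t \<delta> on the
    image; the outer measures are suprema over all positive scales.\<close>
  have "ennreal (rpow t n) * hausdorff_content c n \<delta> A \<le> hausdorff_outer c n (f ` A)" if "0 < \<delta>" for \<delta>
    using content[of "t * \<delta>"] hausdorff_content_le_outer[of "t * \<delta>" c n "f ` A"] that t by simp
  then show ?thesis
    unfolding hausdorff_outer_SUP[of c n A] SUP_mult_left_ennreal by (intro SUP_least) auto
qed

text \<open>Compact balls of integer radius have finite nets of every mesh 1/(j+1), and the union of
  these nets is dense. This provides the second countability behind the Borel sets of
  products.\<close>

lemma dense_countable_of_proper: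
  assumes "proper_space TYPE('a::metric_space)"
  obtains D :: "'a::metric_space set" where "countable D" "\<And>x e. 0 < e \<Longrightarrow> \<exists>d\<in>D. dist x d < e"
proof -
  fix a :: 'a
  have "\<exists>F. finite F \<and> F \<subseteq> cball a (real k) \<and> cball a (real k) \<subseteq> (\<Union>x\<in>F. ball x (1 / real (Suc j)))" for k j
    using assms seq_compact_imp_totally_bounded[of "cball a (real k)"]
    by (simp add: proper_space_def compact_eq_seq_compact_metric)
  then obtain F where F: "\<And>k j. finite (F k j)"
      "\<And>k j. cball a (real k) \<subseteq> (\<Union>x\<in>F k j. ball x (1 / real (Suc j)))"
    by metis
  show thesis
  proof
    show "countable (\<Union>k j. F k j)" using F(1) by (simp add: countable_finite)
    fix x :: 'a and e :: real assume "0 < e"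
    then obtain j where j: "1 / real (Suc j) < e" using nat_approx_posE by blast
    obtain k where "dist a x \<le> real k" using real_arch_simple by blast
    then obtain y where "y \<in> F k j" "dist y x < 1 / real (Suc j)" using F(2)[of k j] by auto
    then show "\<exists>d\<in>\<Union>k j. F k j. dist x d < e" using j by (fastforce simp: dist_commute intro: less_trans)
  qed
qed

text \<open>The theorem \<open>borel_prod\<close> of the library needs a second countable type class.\<close>

lemma sets_borel_prod_of_dense:
  fixes D :: "'a::metric_space set" and E :: "'b::metric_space set"
  assumes D: "countable D" "\<And>x e. 0 < e \<Longrightarrow> \<exists>d\<in>D. dist x d < e"
    and E: "countable E" "\<And>x e. 0 < e \<Longrightarrow> \<exists>d\<in>E. dist x d < e"
  shows "sets (borel \<Otimes>\<^sub>M borel :: ('a \<times> 'b) measure) = sets borel"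
proof
  have "fst \<in> borel_measurable borel" "snd \<in> borel_measurable borel"
    by (auto intro!: borel_measurable_continuous_onI continuous_intros)
  then have "(\<lambda>x. x) \<in> (borel :: ('a \<times> 'b) measure) \<rightarrow>\<^sub>M borel \<Otimes>\<^sub>M borel"
    by (subst measurable_pair_iff) (simp add: comp_def)
  from measurable_sets[OF this] show "sets (borel \<Otimes>\<^sub>M borel :: ('a \<times> 'b) measure) \<subseteq> sets borel"
    by auto
  have "U \<in> sets (borel \<Otimes>\<^sub>M borel)" if U: "open U" for U :: "('a \<times> 'b) set"
  proof -
    define I where "I = {(d, e, k). (d, e, k) \<in> D \<times> E \<times> UNIV \<and>
      ball d (1 / real (Suc k)) \<times> ball e (1 / real (Suc k)) \<subseteq> U}"
    have "U = (\<Union>(d, e, k)\<in>I. ball d (1 / real (Suc k)) \<times> ball e (1 / real (Suc k)))"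
    proof safe
      fix x y assume "(x, y) \<in> U"
      then obtain A B where AB: "open A" "open B" "x \<in> A" "y \<in> B" "A \<times> B \<subseteq> U"
        using U by (auto elim: open_prod_elim)
      then obtain r s where rs: "0 < r" "0 < s" "ball x r \<subseteq> A" "ball y s \<subseteq> B"
        by (meson open_contains_ball)
      \<comment> \<open>Half of the smaller radius: a ball of radius 1/(k+1) with centre that close
        to \<open>x\<close> stays inside \<open>ball x r\<close>, and likewise for
        \<open>y\<close>.\<close>
      then obtain k where k: "1 / real (Suc k) < min r s / 2"
        using nat_approx_posE[of "min r s / 2"] by auto
      obtain d e where de: "d \<in> D" "dist x d < 1 / real (Suc k)" "e \<in> E" "dist y e < 1 / real (Suc k)"
        using D(2)[of "1 / real (Suc k)" x] E(2)[of "1 / real (Suc k)" y] by auto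
      have "ball d (1 / real (Suc k)) \<subseteq> ball x r"
        using de k dist_triangle_less_add[of x d "1 / real (Suc k)" _ "1 / real (Suc k)"]
        by (force simp: dist_commute)
      moreover have "ball e (1 / real (Suc k)) \<subseteq> ball y s"
        using de k dist_triangle_less_add[of y e "1 / real (Suc k)" _ "1 / real (Suc k)"]
        by (force simp: dist_commute)
      ultimately have "ball d (1 / real (Suc k)) \<times> ball e (1 / real (Suc k)) \<subseteq> U"
        using rs AB(5) by (meson Sigma_mono order_trans)
      then have "(d, e, k) \<in> I" using de by (simp add: I_def)
      then show "(x, y) \<in> (\<Union>(d, e, k)\<in>I. ball d (1 / real (Suc k)) \<times> ball e (1 / real (Suc k)))"
        using de by (force simp: dist_commute)
    qed (auto simp: I_def)
    moreover have "countable I"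
      by (rule countable_subset[of _ "D \<times> E \<times> UNIV"]) (use D E in \<open>auto simp: I_def\<close>)
    ultimately show ?thesis
      by (auto intro!: sets.countable_UN'')
  qed
  then show "sets borel \<subseteq> sets (borel \<Otimes>\<^sub>M borel :: ('a \<times> 'b) measure)"
    unfolding sets_borel by (intro sets.sigma_sets_subset') auto
qed

section \<open>Prolongable geodesics\<close>

text \<open>By properness, a subsequence staying away from \<open>l\<close> would have a limit point
  different from \<open>l\<close>. In this form uniqueness of geodesics yields continuity.\<close>

lemma tendsto_of_subseq_limits:
  fixes X :: "nat \<Rightarrow> 'a::metric_space"
  assumes proper: "proper_space TYPE('a)" and bdd: "bounded (range X)"
    and lim: "\<And>r w. strict_mono r \<Longrightarrow> (X \<circ> r) \<longlonglongrightarrow> w \<Longrightarrow> w = l"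
  shows "X \<longlonglongrightarrow> l"
proof (rule ccontr)
  assume "\<not> X \<longlonglongrightarrow> l"
  then obtain e where e: "0 < e" "\<And>N. \<exists>n\<ge>N. e \<le> dist (X n) l"
    unfolding lim_sequentially by (meson not_le)
  then have inf: "infinite {n. e \<le> dist (X n) l}"
    by (auto simp: infinite_nat_iff_unbounded_le)
  define r where "r = enumerate {n. e \<le> dist (X n) l}"
  have r: "strict_mono r" "\<And>n. e \<le> dist (X (r n)) l"
    using enumerate_in_set[OF inf] strict_mono_enumerate[OF inf] by (auto simp: r_def)
  have "compact (closure (range X))"
    using proper bounded_closure[OF bdd] unfolding proper_space_def by blast
  moreover have "\<forall>n. (X \<circ> r) n \<in> closure (range X)"
    using closure_subset[of "range X"] by auto
  ultimately obtain w q where q: "strict_mono q" "((X \<circ> r) \<circ> q) \<longlonglongrightarrow> w"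
    by (meson seq_compactE compact_eq_seq_compact_metric)
  then have "w = l"
    using lim[of "r \<circ> q" w] r(1) by (simp add: comp_assoc strict_mono_o)
  then have "(\<lambda>n. dist (((X \<circ> r) \<circ> q) n) l) \<longlonglongrightarrow> 0"
    using q(2) tendsto_dist_iff by blast
  moreover have "e \<le> dist (((X \<circ> r) \<circ> q) n) l" for n
    using r(2)[of "q n"] by simp
  ultimately have "e \<le> 0" by (meson LIMSEQ_le_const)
  then show False using e by simp
qed

text \<open>The pairs \<open>(x, z)\<close> for which some geodesic from \<open>x\<close> to \<open>z\<close> extends to one from \<open>x\<close> that
  passes through \<open>z\<close> at time \<open>s\<close>.\<close>

definition prolongable :: "real \<Rightarrow> ('a::metric_space \<times> 'a) set" where
  "prolongable s = {(x, z). \<exists>y. dist x z = s * dist x y \<and> dist z y = (1 - s) * dist x y}"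

text \<open>The endpoints \<open>y\<close> of the prolongations satisfy
  \<open>dist x y = dist x z / s\<close>, so they stay bounded along a convergent sequence of pairs.
  Properness gives a limit point, and both equations pass to the limit.\<close>

lemma closed_prolongable:
  assumes proper: "proper_space TYPE('a::metric_space)" and s: "0 < s"
  shows "closed (prolongable s :: ('a \<times> 'a) set)"
  unfolding closed_sequential_limits
proof (intro allI impI, elim conjE)
  fix p :: "nat \<Rightarrow> 'a \<times> 'a" and l
  assume mem: "\<forall>n. p n \<in> prolongable s" and p: "p \<longlonglongrightarrow> l"
  define x z where "x n = fst (p n)" and "z n = snd (p n)" for n
  have xz: "x \<longlonglongrightarrow> fst l" "z \<longlonglongrightarrow> snd l"
    using tendsto_fst[OF p] tendsto_snd[OF p] by (simp_all add: x_def[abs_def] z_def[abs_def])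
  from mem have "\<forall>n. \<exists>y. dist (x n) (z n) = s * dist (x n) y \<and> dist (z n) y = (1 - s) * dist (x n) y"
    by (auto simp: prolongable_def x_def z_def split: prod.splits)
  then obtain y where y: "\<And>n. dist (x n) (z n) = s * dist (x n) (y n)"
      "\<And>n. dist (z n) (y n) = (1 - s) * dist (x n) (y n)"
    by metis
  have "bounded (range (\<lambda>n. dist (x n) (z n) / s))"
    by (rule convergent_imp_bounded) (rule tendsto_intros xz | use s in simp)+
  then obtain B where B: "\<And>n. dist (x n) (z n) / s \<le> B"
    unfolding bounded_real by (meson abs_le_D1 rangeI)
  obtain C where C: "\<And>n. dist (fst l) (x n) \<le> C"
    using convergent_imp_bounded[OF xz(1)] unfolding bounded_any_center[of _ "fst l"] by auto
  have "dist (fst l) (y n) \<le> C + B" for n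
    using dist_triangle[of "fst l" "y n" "x n"] B[of n] C[of n] y(1)[of n] s by simp
  then have "bounded (range y)" unfolding bounded_def by blast
  then have "compact (closure (range y))"
    using proper bounded_closure unfolding proper_space_def by blast
  moreover have "\<forall>n. y n \<in> closure (range y)"
    using closure_subset[of "range y"] by auto
  ultimately obtain w q where q: "strict_mono q" "(y \<circ> q) \<longlonglongrightarrow> w"
    by (meson seq_compactE compact_eq_seq_compact_metric)
  have xzq: "(\<lambda>n. x (q n)) \<longlonglongrightarrow> fst l" "(\<lambda>n. z (q n)) \<longlonglongrightarrow> snd l" "(\<lambda>n. y (q n)) \<longlonglongrightarrow> w"
    using xz[THEN LIMSEQ_subseq_LIMSEQ, OF q(1)] q(2) by (simp_all add: comp_def)
  have "(\<lambda>n. dist (x (q n)) (z (q n))) \<longlonglongrightarrow> dist (fst l) (snd l)"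
       "(\<lambda>n. s * dist (x (q n)) (y (q n))) \<longlonglongrightarrow> s * dist (fst l) w"
       "(\<lambda>n. dist (z (q n)) (y (q n))) \<longlonglongrightarrow> dist (snd l) w"
       "(\<lambda>n. (1 - s) * dist (x (q n)) (y (q n))) \<longlonglongrightarrow> (1 - s) * dist (fst l) w"
    by (intro tendsto_intros xzq)+
  then have "dist (fst l) (snd l) = s * dist (fst l) w" "dist (snd l) w = (1 - s) * dist (fst l) w"
    unfolding y by (meson LIMSEQ_unique)+
  then show "l \<in> prolongable s"
    by (auto simp: prolongable_def split: prod.splits)
qed

section \<open>Unique geodesics and their dependence on the endpoints\<close>

text \<open>The parameters lie strictly between 0 and 1, tend to 1 and are countably many, which
  keeps the union Borel.\<close>

definition prolongable_pairs :: "('a::metric_space \<times> 'a) set" where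
  "prolongable_pairs = (\<Union>k. prolongable (1 - 1 / real (Suc (Suc k))))"

lemma prolongable_pairs_unique:
  fixes x z :: "'a::metric_space"
  assumes "busemann_concave TYPE('a)" "(x, z) \<in> prolongable_pairs"
    and "geodesic \<alpha> x z" "geodesic \<beta> x z" "u \<in> {0..1}"
  shows "\<alpha> u = \<beta> u"
proof -
  obtain k y where "dist x z = (1 - 1 / real (Suc (Suc k))) * dist x y"
      "dist z y = (1 - (1 - 1 / real (Suc (Suc k)))) * dist x y"
    using assms(2) unfolding prolongable_pairs_def prolongable_def by auto
  moreover have "0 < 1 - 1 / real (Suc (Suc k))" "1 - 1 / real (Suc (Suc k)) < 1" by auto
  ultimately show ?thesis
    using geodesic_unique_of_prolongation[OF assms(1,3,4)] assms(5) by blast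
qed

text \<open>On prolongable pairs the choice is harmless, as the geodesic is unique there. The
  constant default and the clamped time make the map total in all three arguments, with a constant
  curve as value off these pairs.\<close>

definition geod :: "'a::metric_space \<Rightarrow> 'a \<Rightarrow> real \<Rightarrow> 'a" where
  "geod x z t = (if (x, z) \<in> prolongable_pairs
     then (SOME \<gamma>. geodesic \<gamma> x z) (max 0 (min 1 t)) else x)"

lemma geodesic_geod:
  fixes x z :: "'a::metric_space"
  assumes "geodesic_space TYPE('a)" "(x, z) \<in> prolongable_pairs"
  shows "geodesic (geod x z) x z"
proof -
  let ?g = "SOME \<gamma>. geodesic \<gamma> x z"
  have "\<exists>\<gamma>. geodesic \<gamma> x z"
    using assms(1) unfolding geodesic_space_def by blast
  then have "geodesic ?g x z" by (rule someI_ex)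
  moreover have "geod x z t = ?g t" if "t \<in> {0..1}" for t
    using that assms(2) by (simp add: geod_def)
  ultimately show ?thesis by (auto simp: geodesic_def)
qed

lemma geod_clamp: "geod x z (max 0 (min 1 t)) = geod x z t"
proof -
  have "max 0 (min 1 (max 0 (min 1 t))) = max 0 (min 1 t)" by linarith
  then show ?thesis by (simp only: geod_def)
qed

text \<open>A limit point of points on the approximating geodesics has the right distances to
  \<open>x\<close> and \<open>z\<close>, so it lies on some geodesic between them at the limit time;
  there is only one such geodesic.\<close>

lemma continuous_on_geod:
  assumes proper: "proper_space TYPE('a::metric_space)" and busemann: "busemann_concave TYPE('a)"
  shows "continuous_on (prolongable_pairs \<times> UNIV) (\<lambda>((x :: 'a, z), t). geod x z t)"
  unfolding continuous_on_sequentially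
proof (intro allI ballI impI, elim conjE)
  fix p :: "nat \<Rightarrow> ('a \<times> 'a) \<times> real" and l
  assume l: "l \<in> prolongable_pairs \<times> UNIV" and mem: "\<forall>n. p n \<in> prolongable_pairs \<times> UNIV"
    and p: "p \<longlonglongrightarrow> l"
  have geo: "geodesic_space TYPE('a)" using busemann by (simp add: busemann_concave_def)
  obtain x z t where l_eq: "l = ((x, z), t)" by (metis surj_pair)
  define X Z T where "X n = fst (fst (p n))" and "Z n = snd (fst (p n))"
    and "T n = max 0 (min 1 (snd (p n)))" for n
  define \<tau> where "\<tau> = max 0 (min 1 t)"
  have XZT: "X \<longlonglongrightarrow> x" "Z \<longlonglongrightarrow> z" "T \<longlonglongrightarrow> \<tau>"
    using tendsto_fst[OF tendsto_fst[OF p]] tendsto_snd[OF tendsto_fst[OF p]]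
      tendsto_max[OF tendsto_const tendsto_min[OF tendsto_const tendsto_snd[OF p]], of 0 1]
    by (simp_all add: l_eq X_def[abs_def] Z_def[abs_def] T_def[abs_def] \<tau>_def)
  have \<tau>: "\<tau> \<in> {0..1}" and T: "T n \<in> {0..1}" for n by (auto simp: \<tau>_def T_def)
  define w where "w n = geod (X n) (Z n) (T n)" for n
  have gn: "geodesic (geod (X n) (Z n)) (X n) (Z n)" for n
    using mem[rule_format, of n] by (intro geodesic_geod[OF geo]) (auto simp: X_def Z_def)
  have w: "dist (X n) (w n) = T n * dist (X n) (Z n)"
      "dist (w n) (Z n) = (1 - T n) * dist (X n) (Z n)" for n
    unfolding w_def using geodesicD(4)[OF gn T] geodesicD(5)[OF gn T] by blast+
  have g: "geodesic (geod x z) x z"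
    using l by (intro geodesic_geod[OF geo]) (simp add: l_eq)
  have "w \<longlonglongrightarrow> geod x z \<tau>"
  proof (rule tendsto_of_subseq_limits[OF proper])
    obtain C where C: "\<And>n. dist x (X n) \<le> C"
      using convergent_imp_bounded[OF XZT(1)] unfolding bounded_any_center[of _ x] by auto
    have "bounded (range (\<lambda>n. dist (X n) (Z n)))"
      by (rule convergent_imp_bounded) (rule tendsto_intros XZT)+
    then obtain B where B: "\<And>n. dist (X n) (Z n) \<le> B"
      unfolding bounded_real by (meson abs_le_D1 rangeI)
    have "dist x (w n) \<le> C + B" for n
    proof -
      have "dist (X n) (w n) \<le> dist (X n) (Z n)"
        using T[of n] w(1)[of n] by (simp add: mult_left_le_one_le)
      then show ?thesis using dist_triangle[of x "w n" "X n"] B[of n] C[of n] by simp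
    qed
    then show "bounded (range w)" unfolding bounded_def by blast
    fix r v assume r: "strict_mono r" and v: "(w \<circ> r) \<longlonglongrightarrow> v"
    have lim: "(\<lambda>n. X (r n)) \<longlonglongrightarrow> x" "(\<lambda>n. Z (r n)) \<longlonglongrightarrow> z" "(\<lambda>n. T (r n)) \<longlonglongrightarrow> \<tau>"
        "(\<lambda>n. w (r n)) \<longlonglongrightarrow> v"
      using XZT[THEN LIMSEQ_subseq_LIMSEQ, OF r] v by (simp_all add: comp_def)
    have "(\<lambda>n. dist (X (r n)) (w (r n))) \<longlonglongrightarrow> dist x v"
         "(\<lambda>n. T (r n) * dist (X (r n)) (Z (r n))) \<longlonglongrightarrow> \<tau> * dist x z"
         "(\<lambda>n. dist (w (r n)) (Z (r n))) \<longlonglongrightarrow> dist v z"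
         "(\<lambda>n. (1 - T (r n)) * dist (X (r n)) (Z (r n))) \<longlonglongrightarrow> (1 - \<tau>) * dist x z"
      by (intro tendsto_intros lim)+
    then have v: "dist x v = \<tau> * dist x z" "dist v z = (1 - \<tau>) * dist x z"
      unfolding w by (meson LIMSEQ_unique)+
    \<comment> \<open>At an interior time, concatenation puts \<open>v\<close> on a geodesic and
      uniqueness applies; for \<tau> equal to 0 or 1 the distances alone give \<open>v = x\<close>
      or \<open>v = z\<close>.\<close>
    show "v = geod x z \<tau>"
    proof (cases "0 < \<tau> \<and> \<tau> < 1")
      case True
      obtain \<alpha> \<beta> where "geodesic \<alpha> x v" "geodesic \<beta> v z"
        using geo unfolding geodesic_space_def by blast
      then have *: "geodesic (\<lambda>u. if u \<le> \<tau> then \<alpha> (u / \<tau>) else \<beta> ((u - \<tau>) / (1 - \<tau>))) x z"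
        by (rule geodesic_concat) (use True v in auto)
      have "\<alpha> 1 = geod x z \<tau>"
        using prolongable_pairs_unique[OF busemann _ * g \<tau>] l True by (simp add: l_eq)
      then show ?thesis using geodesicD(2)[OF \<open>geodesic \<alpha> x v\<close>] by simp
    next
      case False
      then have "\<tau> = 0 \<or> \<tau> = 1" using \<tau> by auto
      then show ?thesis using v geodesicD(1,2)[OF g] by auto
    qed
  qed
  then show "((\<lambda>((x, z), t). geod x z t) \<circ> p) \<longlonglongrightarrow> (\<lambda>((x, z), t). geod x z t) l"
    by (simp add: w_def[abs_def] l_eq comp_def X_def Z_def T_def \<tau>_def geod_clamp split_beta)
qed

lemma prolongable_pairs_borel:
  assumes "proper_space TYPE('a::metric_space)"
  shows "prolongable_pairs \<in> sets (borel :: ('a \<times> 'a) measure)"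
  unfolding prolongable_pairs_def
proof (intro sets.countable_UN image_subsetI borel_closed closed_prolongable[OF assms])
  show "0 < 1 - 1 / real (Suc (Suc k))" for k by simp
qed

lemma sets_borel_pair_of_proper:
  assumes "proper_space TYPE('a::metric_space)"
  shows "sets (borel \<Otimes>\<^sub>M borel) = sets (borel :: ('a \<times> 'a) measure)"
    and "sets ((borel \<Otimes>\<^sub>M borel) \<Otimes>\<^sub>M borel) = sets (borel :: (('a \<times> 'a) \<times> real) measure)"
proof -
  obtain D :: "'a set" where D: "countable D" "\<And>x e. 0 < e \<Longrightarrow> \<exists>d\<in>D. dist x d < e"
    using dense_countable_of_proper[OF assms] by blast
  show *: "sets (borel \<Otimes>\<^sub>M borel) = sets (borel :: ('a \<times> 'a) measure)"
    by (rule sets_borel_prod_of_dense[OF D D])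
  have DD: "\<exists>d\<in>D \<times> D. dist p d < e" if "0 < e" for p :: "'a \<times> 'a" and e
  proof -
    obtain d d' where "d \<in> D" "dist (fst p) d < e / 2" "d' \<in> D" "dist (snd p) d' < e / 2"
      using D(2)[of "e / 2"] \<open>0 < e\<close> by (meson half_gt_zero)
    moreover have "dist p (d, d') \<le> dist (fst p) d + dist (snd p) d'"
      unfolding dist_prod_def by (simp add: sqrt_sum_squares_le_sum)
    ultimately show ?thesis by (intro bexI[of _ "(d, d')"]) auto
  qed
  have Q: "\<exists>q\<in>\<rat>. dist x q < e" if "0 < e" for x e :: real
  proof -
    obtain q where "q \<in> \<rat>" "x < q" "q < x + e"
      using Rats_dense_in_real[of x "x + e"] \<open>0 < e\<close> by auto
    then show ?thesis by (intro bexI[of _ q]) (auto simp: dist_real_def)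
  qed
  have "sets (borel \<Otimes>\<^sub>M borel) = sets (borel :: (('a \<times> 'a) \<times> real) measure)"
    by (rule sets_borel_prod_of_dense[of "D \<times> D" \<rat>]) (use D DD Q countable_rat in auto)
  moreover have "sets ((borel \<Otimes>\<^sub>M borel :: ('a \<times> 'a) measure) \<Otimes>\<^sub>M (borel :: real measure))
      = sets (borel \<Otimes>\<^sub>M borel)"
    by (rule sets_pair_measure_cong[OF * refl])
  ultimately show "sets ((borel \<Otimes>\<^sub>M borel) \<Otimes>\<^sub>M borel) = sets (borel :: (('a \<times> 'a) \<times> real) measure)"
    by simp
qed

text \<open>The map is continuous on the Borel set of prolongable pairs and equals the first
  coordinate elsewhere.\<close>

lemma measurable_geod:
  assumes proper: "proper_space TYPE('a::metric_space)" and busemann: "busemann_concave TYPE('a)"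
  shows "(\<lambda>((x :: 'a, z), t). geod x z t) \<in> (borel \<Otimes>\<^sub>M borel) \<Otimes>\<^sub>M borel \<rightarrow>\<^sub>M borel"
proof -
  let ?W = "prolongable_pairs \<times> UNIV :: (('a \<times> 'a) \<times> real) set"
  let ?B = "borel :: (('a \<times> 'a) \<times> real) measure"
  let ?g = "\<lambda>((x :: 'a, z), t). geod x z t"
  have W: "?W \<in> sets ?B"
    using pair_measureI[OF prolongable_pairs_borel[OF proper] sets.top[of "borel :: real measure"]]
    unfolding sets_borel_pair_of_proper(2)[OF proper, symmetric]
      sets_pair_measure_cong[OF sets_borel_pair_of_proper(1)[OF proper] refl] by simp
  have "(\<lambda>p. if p \<in> ?W then ?g p else fst (fst p)) \<in> borel_measurable ?B"
  proof (subst measurable_If_restrict_space_iff)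
    show "{x \<in> space ?B. x \<in> ?W} \<in> sets ?B" using W by simp
    have "?g \<in> borel_measurable (restrict_space ?B ?W)"
      by (rule borel_measurable_continuous_on_restrict[OF continuous_on_geod[OF assms]])
    moreover have "(\<lambda>p. fst (fst p)) \<in> borel_measurable ?B"
      by (intro borel_measurable_continuous_onI continuous_intros)
    ultimately show "?g \<in> borel_measurable (restrict_space ?B {x. x \<in> ?W}) \<and>
        (\<lambda>p. fst (fst p)) \<in> borel_measurable (restrict_space ?B {x. x \<notin> ?W})"
      by (auto intro: measurable_restrict_space1)
  qed
  moreover have "(\<lambda>p. if p \<in> ?W then ?g p else fst (fst p)) = ?g"
    by (auto simp: geod_def)
  ultimately show ?thesis
    using sets_borel_pair_of_proper(2)[OF proper] by (simp cong: measurable_cong_sets)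
qed

section \<open>Volume comparison and measure contraction\<close>

locale concave_hausdorff =
  fixes n c :: real and p :: "'a::metric_space" and \<rho> :: real
  assumes proper: "proper_space TYPE('a)" and busemann: "busemann_concave TYPE('a)"
    and n: "0 \<le> n" and \<rho>: "0 < \<rho>"
    and pos: "0 < emeasure (hausdorff_measure c n) (ball p \<rho>)"
    and fin: "emeasure (hausdorff_measure c n) (ball p \<rho>) < \<infinity>"
begin

abbreviation m :: "'a measure" where "m \<equiv> hausdorff_measure c n"

lemma geodesic_space: "geodesic_space TYPE('a)"
  using busemann by (simp add: busemann_concave_def)

lemma measurable_m_cong [measurable_cong]: "sets m = sets borel"
  by simp

text \<open>Moving \<open>A\<close> along geodesics towards \<open>x\<close> shrinks its measure by at most \<open>t\<^sup>n\<close>. Since the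
  inequality holds for the outer measure, the selection of the geodesics need not be measurable.\<close>

lemma contraction:
  assumes A: "A \<in> sets borel" and B: "B \<in> sets borel" and t: "0 < t" "t \<le> 1"
    and ex: "\<And>a. a \<in> A \<Longrightarrow> \<exists>\<gamma>. geodesic \<gamma> x a \<and> \<gamma> t \<in> B"
  shows "ennreal (rpow t n) * emeasure m A \<le> emeasure m B"
proof -
  obtain \<gamma> where \<gamma>: "\<And>a. a \<in> A \<Longrightarrow> geodesic (\<gamma> a) x a" "\<And>a. a \<in> A \<Longrightarrow> \<gamma> a t \<in> B"
    using ex by metis
  have "t * dist a b \<le> dist (\<gamma> a t) (\<gamma> b t)" if "a \<in> A" "b \<in> A" for a b
    using busemann_concave_expand[OF busemann \<gamma>(1)[OF that(1)] \<gamma>(1)[OF that(2)], of 1 t] t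
      geodesicD(2)[OF \<gamma>(1)[OF that(1)]] geodesicD(2)[OF \<gamma>(1)[OF that(2)]] by simp
  then have "ennreal (rpow t n) * hausdorff_outer c n A \<le> hausdorff_outer c n ((\<lambda>a. \<gamma> a t) ` A)"
    by (rule hausdorff_outer_expand[OF n t(1)])
  also have "\<dots> \<le> hausdorff_outer c n B"
    by (rule hausdorff_outer_mono) (use \<gamma>(2) in auto)
  finally show ?thesis using A B by (simp add: emeasure_hausdorff_measure)
qed

section \<open>Volumes of balls\<close>

lemma contraction_ball:
  assumes t: "0 < t" "t \<le> 1"
  shows "ennreal (rpow t n) * emeasure m (ball x R) \<le> emeasure m (ball x (t * R))"
proof (rule contraction[OF _ _ t])
  fix a assume a: "a \<in> ball x R"
  obtain \<gamma> where \<gamma>: "geodesic \<gamma> x a" using geodesic_space unfolding geodesic_space_def by blast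
  have "dist x (\<gamma> t) < t * R"
    using geodesicD(4)[OF \<gamma>, of t] t a by simp
  with \<gamma> show "\<exists>\<gamma>. geodesic \<gamma> x a \<and> \<gamma> t \<in> ball x (t * R)" by auto
qed auto

text \<open>A large ball around \<open>p\<close> is contracted into \<open>ball p \<rho>\<close>,
  whose measure is finite. \<open>S\<close> is at least \<rho> so that the factor \<rho>/S is at
  most 1.\<close>

lemma emeasure_ball_less_top: "emeasure m (ball x R) < \<infinity>"
proof -
  define S where "S = max (R + dist p x) \<rho>"
  have S: "\<rho> \<le> S" "0 < S" "R + dist p x \<le> S" using \<rho> by (auto simp: S_def)
  have "ennreal (rpow (\<rho> / S) n) * emeasure m (ball p S) \<le> emeasure m (ball p \<rho>)"
    using contraction_ball[of "\<rho> / S" p S] \<rho> S by simp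
  then have "ennreal (rpow (\<rho> / S) n) * emeasure m (ball p S) < \<top>"
    using fin by (simp add: le_less_trans)
  moreover have "0 < rpow (\<rho> / S) n" using \<rho> S by (simp add: rpow_pos)
  ultimately have "emeasure m (ball p S) < \<top>"
    by (auto simp: ennreal_mult_less_top)
  moreover have "ball x R \<subseteq> ball p S"
    using S dist_triangle[of p _ x] by (auto simp: subset_iff) (smt (verit))
  ultimately show ?thesis
    using emeasure_mono[of "ball x R" "ball p S" m] by (simp add: le_less_trans)
qed

text \<open>A ball around \<open>x\<close> large enough to contain \<open>ball p \<rho>\<close> is
  contracted into \<open>ball x r\<close>.\<close>

lemma emeasure_ball_pos:
  assumes "0 < r"
  shows "0 < emeasure m (ball x r)"
proof -
  define S where "S = max (\<rho> + dist x p) r"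
  have S: "0 < S" "r \<le> S" using assms by (auto simp: S_def)
  have "ball p \<rho> \<subseteq> ball x S"
    using dist_triangle[of x _ p] by (auto simp: subset_iff S_def) (smt (verit))
  then have "0 < emeasure m (ball x S)"
    using emeasure_mono[of "ball p \<rho>" "ball x S" m] pos by (simp add: less_le_trans)
  then have "0 < ennreal (rpow (r / S) n) * emeasure m (ball x S)"
    using assms S rpow_pos[of "r / S" n] by (simp add: ennreal_zero_less_mult_iff)
  also have "\<dots> \<le> emeasure m (ball x r)"
    using contraction_ball[of "r / S" x S] assms S by simp
  finally show ?thesis .
qed

lemma emeasure_ball_le:
  assumes "0 < r" "r \<le> R"
  shows "emeasure m (ball x R) \<le> ennreal (rpow (R / r) n) * emeasure m (ball x r)"
proof -
  have "rpow (R / r) n * rpow (r / R) n = 1"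
    using assms rpow_mult[of "R / r" "r / R" n] by simp
  then have "emeasure m (ball x R)
      = ennreal (rpow (R / r) n) * (ennreal (rpow (r / R) n) * emeasure m (ball x R))"
    by (simp add: mult.assoc[symmetric] ennreal_mult[symmetric] rpow_nonneg)
  also have "\<dots> \<le> ennreal (rpow (R / r) n) * emeasure m (ball x r)"
    using contraction_ball[of "r / R" x R] assms by (intro mult_left_mono) auto
  finally show ?thesis .
qed

lemma BG0_m: "BG0 n m"
  unfolding BG0_def
proof (intro conjI allI impI)
  fix x :: 'a and r R :: real assume r: "0 < r \<and> r < R"
  have "rpow (R / r) n * rpow r n = rpow R n"
    using r rpow_mult[of "R / r" r n] by simp
  then have eq: "rpow (R / r) n = rpow R n / rpow r n"
    using rpow_pos[of r n] r by (simp add: field_simps)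
  have "emeasure m (ball x r) \<noteq> 0" "emeasure m (ball x r) \<noteq> \<top>"
    using emeasure_ball_pos[of r x] emeasure_ball_less_top[of x r] r by auto
  then show "emeasure m (ball x R) / emeasure m (ball x r) \<le> ennreal (rpow R n / rpow r n)"
    using emeasure_ball_le[of r R x] r unfolding eq[symmetric]
    by (metis divide_right_mono_ennreal ennreal_mult_divide_eq less_imp_le)
qed (use emeasure_ball_pos emeasure_ball_less_top in auto)

lemma doubling:
  assumes "0 < r"
  shows "emeasure m (ball x (2 * r)) \<le> ennreal (2 powr n) * emeasure m (ball x r)"
  using emeasure_ball_le[of r "2 * r" x] assms by (simp add: rpow_def split: if_splits)

lemma UN_ball: "(\<Union>k. ball x (real k)) = UNIV"
  by (auto intro: reals_Archimedean2)

lemma sigma_finite: "sigma_finite_measure m"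
proof
  fix a :: 'a
  show "\<exists>A. countable A \<and> A \<subseteq> sets m \<and> \<Union>A = space m \<and> (\<forall>a\<in>A. emeasure m a \<noteq> \<infinity>)"
    using UN_ball[of a] emeasure_ball_less_top[of a]
    by (intro exI[of _ "range (\<lambda>k. ball a (real k))"]) (auto simp: less_top)
qed

section \<open>Uniqueness of geodesics almost everywhere\<close>

lemma AE_prolongable: "AE z in m. (x, z) \<in> prolongable_pairs"
proof -
  define s where "s k = 1 - 1 / real (Suc (Suc k))" for k
  have s: "0 < s k" "s k < 1" for k by (auto simp: s_def)
  define D where "D = {z. (x, z) \<in> prolongable_pairs}"
  have Dk: "closed {z. (x, z) \<in> prolongable (s k)}" for k
  proof -
    have "closed (Pair x -` prolongable (s k))"
      by (rule closed_vimage[OF closed_prolongable[OF proper s(1)]]) (intro continuous_intros)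
    then show ?thesis by (simp add: vimage_def)
  qed
  have "D = (\<Union>k. {z. (x, z) \<in> prolongable (s k)})"
    by (auto simp: D_def prolongable_pairs_def s_def)
  then have D: "D \<in> sets borel"
    using Dk by auto
  have null: "emeasure m (ball x R - D) = 0" for R
  proof -
    have fm: "A \<in> fmeasurable m" if "A \<in> sets borel" "A \<subseteq> ball x R" for A
      using that emeasure_ball_less_top[of x R] emeasure_mono[of A "ball x R" m]
      by (intro fmeasurableI) (auto simp: le_less_trans)
    have "rpow (s k) n * measure m (ball x R) \<le> measure m (ball x R \<inter> D)" for k
    proof -
      have "ennreal (rpow (s k) n) * emeasure m (ball x R) \<le> emeasure m (ball x R \<inter> D)"
      proof (rule contraction)
        fix a assume a: "a \<in> ball x R"
        obtain \<gamma> where \<gamma>: "geodesic \<gamma> x a"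
          using geodesic_space unfolding geodesic_space_def by blast
        have d: "dist x (\<gamma> (s k)) = s k * dist x a" "dist (\<gamma> (s k)) a = (1 - s k) * dist x a"
          using geodesicD(4,5)[OF \<gamma>, of "s k"] s[of k] by auto
        \<comment> \<open>The rest of \<gamma> itself is the prolongation beyond
          \<open>\<gamma> (s k)\<close>; the witness is \<open>y = a\<close>.\<close>
        then have "(x, \<gamma> (s k)) \<in> prolongable (s k)" by (auto simp: prolongable_def)
        then have "\<gamma> (s k) \<in> D" by (auto simp: D_def prolongable_pairs_def s_def)
        moreover have "s k * dist x a \<le> dist x a" using s[of k] by (simp add: mult_left_le_one_le)
        then have "\<gamma> (s k) \<in> ball x R" using d(1) a by simp
        ultimately show "\<exists>\<gamma>. geodesic \<gamma> x a \<and> \<gamma> (s k) \<in> ball x R \<inter> D"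
          using \<gamma> by auto
      qed (use D s[of k] in auto)
      moreover have "ball x R \<in> fmeasurable m" "ball x R \<inter> D \<in> fmeasurable m"
        using D by (auto intro!: fm)
      ultimately show ?thesis
        by (simp add: emeasure_eq_measure2 ennreal_mult[symmetric] rpow_nonneg)
    qed
    moreover have "(\<lambda>k. rpow (s k) n * measure m (ball x R)) \<longlonglongrightarrow> 1 * measure m (ball x R)"
    proof (intro tendsto_mult tendsto_const)
      have "s \<longlonglongrightarrow> 1 - 0"
        unfolding s_def[abs_def]
        by (intro tendsto_diff tendsto_const LIMSEQ_Suc[OF LIMSEQ_Suc[OF lim_1_over_n]])
      then have "(\<lambda>k. s k powr n) \<longlonglongrightarrow> (1 - 0) powr n"
        by (intro tendsto_powr tendsto_const) auto
      then show "(\<lambda>k. rpow (s k) n) \<longlonglongrightarrow> 1"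
        by (cases "n = 0") (auto simp: rpow_def)
    qed
    ultimately have "measure m (ball x R) \<le> measure m (ball x R \<inter> D)"
      by (auto intro: LIMSEQ_le_const2)
    \<comment> \<open>The ball has finite measure, so equality of the two measures makes the
      difference a null set.\<close>
    moreover have "measure m (ball x R - (ball x R \<inter> D)) = measure m (ball x R) - measure m (ball x R \<inter> D)"
      using D by (intro measurable_measure_Diff fm) auto
    then have "measure m (ball x R - D) = measure m (ball x R) - measure m (ball x R \<inter> D)"
      by (simp add: Diff_Int)
    moreover have "ball x R - D \<in> fmeasurable m" using D by (auto intro!: fm)
    ultimately show ?thesis
      using emeasure_eq_measure2[of "ball x R - D" m] measure_nonneg[of m "ball x R - D"] by auto
  qed
  have "emeasure m (\<Union>k. ball x (real k) - D) = 0"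
    by (rule emeasure_UN_eq_0) (use null D in auto)
  moreover have "(\<Union>k. ball x (real k) - D) = {z. (x, z) \<notin> prolongable_pairs}"
    using UN_ball[of x] by (auto simp: D_def)
  ultimately show ?thesis
    using borel_comp[OF D] by (intro AE_I[of _ _ "- D"]) (auto simp: D_def Compl_eq)
qed

section \<open>The geodesic as a measurable function of its endpoint\<close>

lemma restrict_geod_geodesics: "restrict (geod (x :: 'a) z) {0..1} \<in> geodesics"
proof (cases "(x, z) \<in> prolongable_pairs")
  case True
  from geodesic_geod[OF geodesic_space this] show ?thesis
    by (auto simp: geodesics_def geodesic_def intro!: exI[of _ x] exI[of _ z])
next
  case False
  then show ?thesis
    by (auto simp: geodesics_def geodesic_def geod_def intro!: exI[of _ x])
qed

text \<open>Compactness of the time interval turns joint continuity in endpoint and time into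
  closeness uniform in time, which is what the metric on geodesics measures.\<close>

lemma continuous_geodesics_into_metric:
  fixes x z :: 'a
  assumes z: "(x, z) \<in> prolongable_pairs" and U: "openin (mtopology_of geodesics_metric) U"
    and mem: "restrict (geod x z) {0..1} \<in> U"
  obtains V where "open V" "z \<in> V"
    "\<And>y. y \<in> V \<Longrightarrow> (x, y) \<in> prolongable_pairs \<Longrightarrow> restrict (geod x y) {0..1} \<in> U"
proof -
  let ?G = "geodesics_metric :: (real \<Rightarrow> 'a) metric"
  let ?S = "\<lambda>z. restrict (geod x z) {0..1}"
  let ?D = "{z. (x, z) \<in> prolongable_pairs}"
  interpret G: Metric_space geodesics "mdist ?G"
    using Metric_space_mspace_mdist[of ?G] by simp
  have S: "?S y \<in> geodesics" for y by (rule restrict_geod_geodesics)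
  obtain r where r: "0 < r" "G.mball (?S z) r \<subseteq> U"
    using U mem by (auto simp: mtopology_of_def G.openin_mtopology)
  let ?f = "\<lambda>(z, t). geod x z t"
  have cont: "continuous_on (?D \<times> {0..1}) ?f"
  proof -
    have c1: "continuous_on (?D \<times> {0..1}) (\<lambda>q. ((x, fst q), snd q))"
      by (intro continuous_intros)
    have c2: "(\<lambda>q. ((x, fst q), snd q)) ` (?D \<times> {0..1}) \<subseteq> prolongable_pairs \<times> (UNIV :: real set)"
      by auto
    show ?thesis
      using continuous_on_compose2[OF continuous_on_geod[OF proper busemann] c1 c2]
      by (simp add: split_beta)
  qed
  have zD: "z \<in> ?D" and half: "0 < r / 2" using z r(1) by auto
  obtain V where V: "z \<in> V" "open V"
    and close: "\<forall>y\<in>V \<inter> ?D. \<forall>t\<in>{0..1}. dist (?f (y, t)) (?f (z, t)) \<le> r / 2"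
    by (rule continuous_on_prod_compactE[OF cont compact_Icc zD half])
  show thesis
  proof (rule that[OF V(2,1)])
    fix y assume y: "y \<in> V" "(x, y) \<in> prolongable_pairs"
    have "mdist (funspace {0..1} euclidean_metric) (?S z) (?S y) \<le> r / 2"
    proof (subst funspace_mdist_le)
      show "?S z \<in> mspace (funspace {0..1} euclidean_metric)" "?S y \<in> mspace (funspace {0..1} euclidean_metric)"
        using S[of z] S[of y] geodesics_subset_fspace by blast+
      show "\<forall>t\<in>{0..1}. mdist euclidean_metric (?S z t) (?S y t) \<le> r / 2"
        using close y by (auto simp: dist_commute)
    qed simp
    then have "?S y \<in> G.mball (?S z) r"
      using S[of z] S[of y] r(1) unfolding G.in_mball by (simp add: geodesics_metric_def)
    then show "?S y \<in> U" using r(2) by auto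
  qed
qed

lemma section_prolongable_borel: "{z. (x :: 'a, z) \<in> prolongable_pairs} \<in> sets borel"
proof -
  have "Pair x \<in> borel \<rightarrow>\<^sub>M (borel \<Otimes>\<^sub>M borel)" by simp
  from measurable_sets[OF this, of prolongable_pairs] show ?thesis
    using prolongable_pairs_borel[OF proper] sets_borel_pair_of_proper(1)[OF proper]
    by (simp add: vimage_def)
qed

lemma measurable_restrict_geod: "(\<lambda>z. restrict (geod (x :: 'a) z) {0..1}) \<in> borel \<rightarrow>\<^sub>M geodesics_borel"
  (is "?S \<in> _")
  unfolding geodesics_borel_def
proof (rule measurable_measure_of)
  show "{U. openin (mtopology_of geodesics_metric) U} \<subseteq> Pow (geodesics :: (real \<Rightarrow> 'a) set)"
    using openin_subset[of "mtopology_of (geodesics_metric :: (real \<Rightarrow> 'a) metric)"] by auto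
  show "?S \<in> space borel \<rightarrow> geodesics" using restrict_geod_geodesics by auto
  fix U :: "(real \<Rightarrow> 'a) set" assume "U \<in> {U. openin (mtopology_of geodesics_metric) U}"
  then have U: "openin (mtopology_of geodesics_metric) U" by simp
  let ?D = "{z. (x, z) \<in> prolongable_pairs}"
  \<comment> \<open>\<open>?C\<close> is empty or everything, since all \<open>z\<close> outside
    \<open>?D\<close> have the same constant curve. \<open>V\<close> is the largest open set whose
    trace on \<open>?D\<close> is mapped into \<open>U\<close>.\<close>
  let ?C = "{z. restrict (\<lambda>_. x) {0..1} \<in> U}"
  define V where "V = \<Union>{V. open V \<and> V \<inter> ?D \<subseteq> ?S -` U}"
  have V: "open V" by (auto simp: V_def)
  have "?S -` U = (V \<inter> ?D) \<union> (?C - ?D)"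
  proof (intro set_eqI)
    fix z
    show "z \<in> ?S -` U \<longleftrightarrow> z \<in> (V \<inter> ?D) \<union> (?C - ?D)"
    proof (cases "z \<in> ?D")
      case True
      have "z \<in> V" if zU: "?S z \<in> U"
      proof -
        obtain V' where "open V'" "z \<in> V'" "\<And>y. y \<in> V' \<Longrightarrow> (x, y) \<in> prolongable_pairs \<Longrightarrow> ?S y \<in> U"
          using continuous_geodesics_into_metric[OF _ U zU] True by auto
        then show ?thesis unfolding V_def by blast
      qed
      moreover have "?S z \<in> U" if "z \<in> V" using that True by (auto simp: V_def)
      ultimately show ?thesis using True by auto
    next
      case False
      then show ?thesis by (auto simp: geod_def[abs_def])
    qed
  qed
  moreover have "(V \<inter> ?D) \<union> (?C - ?D) \<in> sets borel"
    using V section_prolongable_borel by (intro sets.Un sets.Int sets.Diff) auto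
  ultimately show "?S -` U \<inter> space borel \<in> sets borel" by simp
qed

text \<open>In dimension 0 the measure of a ball does not depend on its radius: shrinking balls
  leave the atom at \<open>x\<close>, growing balls exhaust the space. This serves MCP at time 0,
  where \<open>rpow 0 0 = 1\<close>.\<close>

lemma emeasure_le_singleton:
  assumes "n = 0"
  shows "emeasure m A \<le> emeasure m {x}"
proof -
  have small: "emeasure m (ball x R) \<le> emeasure m {x}" if "0 < R" for R
  proof -
    let ?B = "\<lambda>k. ball x (R / real (Suc k))"
    have "(\<lambda>k. emeasure m (?B k)) \<longlonglongrightarrow> emeasure m (\<Inter>k. ?B k)"
    proof (rule Lim_emeasure_decseq)
      show "decseq ?B"
        using that by (auto simp: decseq_def intro!: subset_ball divide_left_mono)
    qed (use emeasure_ball_less_top in \<open>auto simp: less_top\<close>)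
    moreover have "(\<Inter>k. ?B k) = {x}"
    proof -
      have "y = x" if y: "\<forall>k. dist x y < R / real (Suc k)" for y
      proof (rule ccontr)
        assume "y \<noteq> x"
        then have "0 < dist x y / R" using \<open>0 < R\<close> by simp
        then obtain k where "1 / real (Suc k) < dist x y / R" using nat_approx_posE by blast
        then have "R / real (Suc k) < dist x y" using \<open>0 < R\<close> by (simp add: field_simps)
        then show False using y by (meson less_asym)
      qed
      then show ?thesis using \<open>0 < R\<close> by auto
    qed
    moreover have "emeasure m (ball x R) \<le> emeasure m (?B k)" for k
      using emeasure_ball_le[of "R / real (Suc k)" R x] that assms
      by (simp add: rpow_def divide_le_eq mult_le_cancel_left1)
    ultimately show ?thesis by (auto intro: LIMSEQ_le_const)
  qed
  have "(\<lambda>k. emeasure m (ball x (real k))) \<longlonglongrightarrow> emeasure m (\<Union>k. ball x (real k))"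
    by (rule Lim_emeasure_incseq) (auto simp: incseq_def intro!: subset_ball)
  moreover have "emeasure m (ball x (real k)) \<le> emeasure m {x}" for k
    using small[of "real k"] by (cases "k = 0") auto
  ultimately have "emeasure m UNIV \<le> emeasure m {x}"
    unfolding UN_ball by (auto intro: LIMSEQ_le_const2)
  then show ?thesis
    using emeasure_space[of m A] by (simp add: order_trans)
qed

lemma MCP0_m: "MCP0 n m"
  unfolding MCP0_def
proof (intro allI ballI impI, elim conjE)
  fix x :: 'a and A assume A: "A \<in> sets m" and Apos: "0 < emeasure m A" and Afin: "emeasure m A < \<infinity>"
  let ?S = "\<lambda>z. restrict (geod x z) {0..1}"
  define u where "u = uniform_measure m A"
  define Q where "Q = distr u geodesics_borel ?S"
  have sets_u [measurable_cong]: "sets u = sets borel" by (simp add: u_def)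
  have space_u [simp]: "space u = UNIV" by (simp add: u_def)
  interpret u: prob_space u
    unfolding u_def by (rule prob_space_uniform_measure) (use Apos Afin in auto)
  have S [measurable]: "?S \<in> u \<rightarrow>\<^sub>M geodesics_borel"
    using measurable_restrict_geod[of x] by (simp cong: measurable_cong_sets add: sets_u)
  interpret Q: prob_space Q unfolding Q_def by (rule u.prob_space_distr[OF S])
  have eval: "(\<lambda>\<gamma>. \<gamma> t) \<in> geodesics_borel \<rightarrow>\<^sub>M (borel :: 'a measure)" if "t \<in> {0..1}" for t
    using measurable_eval_geodesics[OF that] .
  have distr_eval: "distr Q borel (\<lambda>\<gamma>. \<gamma> t) = distr u borel (\<lambda>z. geod x z t)" if "t \<in> {0..1}" for t
    unfolding Q_def using distr_distr[OF eval[OF that] S] that by (simp add: comp_def)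
  have meas: "(\<lambda>z. geod x z t) \<in> borel_measurable borel" if "t \<in> {0..1}" for t
    using measurable_compose[OF measurable_restrict_geod[of x] eval[OF that]] that by simp
  have geod0: "geod x z 0 = x" for z
    using geodesicD(1)[OF geodesic_geod[OF geodesic_space, of x z]]
    by (cases "(x, z) \<in> prolongable_pairs") (auto simp: geod_def)
  have AE_u: "AE z in u. (x, z) \<in> prolongable_pairs"
    unfolding u_def using AE_prolongable[of x] A by (intro AE_uniform_measureI) auto
  show "\<exists>Q. sets Q = sets geodesics_borel \<and> prob_space Q \<and>
      distr Q borel (\<lambda>\<gamma>. \<gamma> 0) = return borel x \<and>
      distr Q borel (\<lambda>\<gamma>. \<gamma> 1) = uniform_measure m A \<and>
      (\<forall>t\<in>{0..1}. distr (scale_measure (ennreal (rpow t n) * emeasure m A) Q) borel (\<lambda>\<gamma>. \<gamma> t) \<le> m)"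
  proof (intro exI[of _ Q] conjI ballI)
    show "sets Q = sets geodesics_borel" by (simp add: Q_def)
    show "prob_space Q" by (rule Q.prob_space_axioms)
    show "distr Q borel (\<lambda>\<gamma>. \<gamma> 0) = return borel x"
      using distr_eval[of 0] u.distr_const[of x borel] by (simp add: geod0)
    \<comment> \<open>\<open>geod x z 1\<close> is the default \<open>x\<close> off the prolongable
      pairs, so it agrees with \<open>z\<close> only almost everywhere.\<close>
    have "distr u borel (\<lambda>z. geod x z 1) = distr u borel (\<lambda>z. z)"
    proof (rule distr_cong_AE)
      show "AE z in u. geod x z 1 = z"
        using AE_u by (rule eventually_mono) (rule geodesicD(2)[OF geodesic_geod[OF geodesic_space]])
    qed (use meas[of 1] sets_u in \<open>auto cong: measurable_cong_sets\<close>)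
    then show "distr Q borel (\<lambda>\<gamma>. \<gamma> 1) = uniform_measure m A"
      using distr_eval[of 1] distr_id2[of borel u] sets_u by (simp add: u_def)
    fix t :: real assume t: "t \<in> {0..1}"
    let ?c = "ennreal (rpow t n) * emeasure m A"
    \<comment> \<open>The factor \<open>emeasure m A\<close> demanded by MCP undoes the
      normalization of \<open>u\<close>.\<close>
    have cancel: "emeasure m A * (e / emeasure m A) = e" for e
    proof -
      have "emeasure m A * (e / emeasure m A) = e * emeasure m A / emeasure m A"
        by (simp only: ennreal_times_divide mult.commute[of "emeasure m A" e])
      also have "\<dots> = e" by (rule ennreal_mult_divide_eq) (use Apos Afin in auto)
      finally show ?thesis .
    qed
    have val: "emeasure (distr (scale_measure ?c Q) borel (\<lambda>\<gamma>. \<gamma> t)) B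
        = ennreal (rpow t n) * emeasure m (A \<inter> {z. geod x z t \<in> B})" if B: "B \<in> sets borel" for B
    proof -
      have ev: "(\<lambda>\<gamma>. \<gamma> t) \<in> borel_measurable Q" "(\<lambda>\<gamma>. \<gamma> t) \<in> borel_measurable (scale_measure ?c Q)"
        using eval[OF t] by (simp_all add: Q_def cong: measurable_cong_sets)
      have "emeasure (distr (scale_measure ?c Q) borel (\<lambda>\<gamma>. \<gamma> t)) B = ?c * emeasure (distr Q borel (\<lambda>\<gamma>. \<gamma> t)) B"
        using B ev by (simp add: emeasure_distr space_scale_measure)
      also have "emeasure (distr Q borel (\<lambda>\<gamma>. \<gamma> t)) B = emeasure u {z. geod x z t \<in> B}"
        unfolding distr_eval[OF t] using B meas[OF t] sets_u
        by (subst emeasure_distr) (auto simp: vimage_def cong: measurable_cong_sets)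
      also have "\<dots> = emeasure m (A \<inter> {z. geod x z t \<in> B}) / emeasure m A"
        unfolding u_def using A measurable_sets[OF meas[OF t] B]
        by (intro emeasure_uniform_measure) (auto simp: vimage_def)
      finally show ?thesis
        by (simp only: mult.assoc cancel)
    qed
    have "ennreal (rpow t n) * emeasure m (A \<inter> {z. geod x z t \<in> B}) \<le> emeasure m B"
      if B: "B \<in> sets borel" for B
    \<comment> \<open>Contraction requires a positive time. At time 0 the left side vanishes unless
      \<open>n = 0\<close> and \<open>x \<in> B\<close>, and then the atom at \<open>x\<close>
      bounds it.\<close>
    proof (cases "t = 0")
      case True
      show ?thesis
      proof (cases "n = 0 \<and> x \<in> B")
        case True
        have "emeasure m (A \<inter> {z. geod x z t \<in> B}) \<le> emeasure m {x}"
          using True by (intro emeasure_le_singleton) auto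
        also have "\<dots> \<le> emeasure m B" using True B by (intro emeasure_mono) auto
        finally show ?thesis using True by (simp add: rpow_def)
      qed (use \<open>t = 0\<close> geod0 in \<open>auto simp: rpow_def\<close>)
    next
      case False
      let ?E = "A \<inter> {z. geod x z t \<in> B}"
      let ?D = "{z. (x, z) \<in> prolongable_pairs}"
      have E: "?E \<in> sets borel"
        using A measurable_sets[OF meas[OF t] B] by (auto simp: vimage_def)
      \<comment> \<open>Only for prolongable pairs is \<open>geod x z\<close> known to end at
        \<open>z\<close>, so the exceptional null set is removed before contracting.\<close>
      have "emeasure m ?E = emeasure m (?E \<inter> ?D)"
        using AE_prolongable[of x] E section_prolongable_borel by (intro emeasure_eq_AE) auto
      also have "ennreal (rpow t n) * \<dots> \<le> emeasure m B"
        by (rule contraction[of _ _ t x])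
          (use E B t False section_prolongable_borel geodesic_geod[OF geodesic_space] in auto)
      finally show ?thesis .
    qed
    then show "distr (scale_measure ?c Q) borel (\<lambda>\<gamma>. \<gamma> t) \<le> m"
      by (subst le_measure) (auto simp: val)
  qed
qed

end

section \<open>Upper gradients along geodesics\<close>

lemma curve_length_geodesic:
  assumes \<gamma>: "geodesic \<gamma> x y" and t: "t \<in> {0..1}"
  shows "curve_length \<gamma> 0 t = ennreal (t * dist x y)"
  unfolding curve_length_def
proof (rule antisym)
  show "(SUP (p, N) \<in> {(p::nat \<Rightarrow> real, N::nat). mono p \<and> range p \<subseteq> {0..t}}.
      \<Sum>i<N. ennreal (dist (\<gamma> (p i)) (\<gamma> (p (Suc i))))) \<le> ennreal (t * dist x y)"
  proof (rule SUP_least, clarify)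
    fix p :: "nat \<Rightarrow> real" and N assume p: "mono p" "range p \<subseteq> {0..t}"
    have p': "p i \<in> {0..t}" for i using p(2) by blast
    then have p'': "p i \<in> {0..1}" for i using t by (meson atLeastAtMost_iff order_trans)
    have "dist (\<gamma> (p i)) (\<gamma> (p (Suc i))) = (p (Suc i) - p i) * dist x y" for i
      using geodesicD(3)[OF \<gamma> p'' p'', of i "Suc i"] monoD[OF p(1), of i "Suc i"] by simp
    then have "(\<Sum>i<N. ennreal (dist (\<gamma> (p i)) (\<gamma> (p (Suc i)))))
        = ennreal (\<Sum>i<N. (p (Suc i) - p i) * dist x y)"
      by (metis (no_types, lifting) sum_ennreal sum.cong zero_le_dist)
    also have "(\<Sum>i<N. (p (Suc i) - p i) * dist x y) = (p N - p 0) * dist x y"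
      by (simp add: sum_distrib_right[symmetric] sum_lessThan_telescope)
    also have "\<dots> \<le> t * dist x y"
      using p'[of N] p'[of 0] by (intro mult_right_mono) auto
    finally show "(\<Sum>i<N. ennreal (dist (\<gamma> (p i)) (\<gamma> (p (Suc i))))) \<le> ennreal (t * dist x y)"
      by (simp add: ennreal_leI)
  qed
  \<comment> \<open>The partition with the two points 0 and \<open>t\<close> already attains the
    length of a geodesic.\<close>
  have "mono (\<lambda>i::nat. if i = 0 then 0 else t)" "range (\<lambda>i::nat. if i = 0 then 0 else t) \<subseteq> {0..t}"
    using t by (auto intro!: monoI)
  then show "ennreal (t * dist x y) \<le> (SUP (p, N) \<in> {(p::nat \<Rightarrow> real, N::nat). mono p \<and> range p \<subseteq> {0..t}}.
      \<Sum>i<N. ennreal (dist (\<gamma> (p i)) (\<gamma> (p (Suc i)))))"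
    by (intro SUP_upper2[of "(\<lambda>i. if i = 0 then 0 else t, 1)"])
      (use geodesicD(1)[OF \<gamma>] geodesicD(4)[OF \<gamma> t] in auto)
qed

lemma rectifiable_geodesic: "geodesic \<gamma> x y \<Longrightarrow> rectifiable \<gamma>"
  using curve_length_geodesic[of \<gamma> x y 1] by (simp add: rectifiable_def continuous_on_geodesic)

text \<open>The length of a geodesic grows linearly, so its arc length parameter is
  \<open>s / L\<close> and the formula is an affine substitution.\<close>

lemma curve_integral_geodesic:
  assumes \<gamma>: "geodesic \<gamma> x y" and g [measurable]: "g \<in> borel_measurable borel"
  shows "curve_integral \<gamma> g = ennreal (dist x y) * (\<integral>\<^sup>+t\<in>{0..1}. g (\<gamma> t) \<partial>lborel)"
proof -
  define L where "L = dist x y"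
  have len: "curve_length \<gamma> 0 1 = ennreal L" "enn2real (curve_length \<gamma> 0 1) = L"
    using curve_length_geodesic[OF \<gamma>, of 1] by (simp_all add: L_def)
  show ?thesis
  proof (cases "L = 0")
    \<comment> \<open>The interval of integration is a point, and on the right the factor 0 prevails
      even over an infinite integral.\<close>
    case True
    have "(\<integral>\<^sup>+s\<in>{0..0::real}. g (arclength_param \<gamma> s) \<partial>lborel) = 0"
      by (rule nn_integral_null_set) (simp add: null_sets_def)
    then show ?thesis using True unfolding curve_integral_def len(2) by (simp add: L_def)
  next
    case False
    then have L: "0 < L" by (simp add: L_def)
    \<comment> \<open>Clamping the time extends \<gamma> continuously to the whole line, as the
      substitution on \<open>lborel\<close> requires.\<close>
    define \<eta> where "\<eta> t = \<gamma> (max 0 (min 1 t))" for t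
    have "continuous_on UNIV \<eta>"
      unfolding \<eta>_def
      by (rule continuous_on_compose2[OF continuous_on_geodesic[OF \<gamma>]]) (auto intro!: continuous_intros)
    then have \<eta> [measurable]: "\<eta> \<in> borel_measurable borel" by (rule borel_measurable_continuous_onI)
    have arc: "arclength_param \<gamma> s = \<eta> (s / L)" if s: "s \<in> {0..L}" for s
    proof -
      have sL: "s / L \<in> {0..1}" "s / L * L = s" using s L by auto
      have "(t \<in> {0..1} \<and> curve_length \<gamma> 0 t = ennreal s) \<longleftrightarrow> t = s / L" for t
      proof
        assume "t \<in> {0..1} \<and> curve_length \<gamma> 0 t = ennreal s"
        then have "t * L = s"
          using curve_length_geodesic[OF \<gamma>, of t] s L unfolding L_def[symmetric] by (simp add: ennreal_inj)
        then show "t = s / L" using L by (simp add: field_simps)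
      next
        assume "t = s / L"
        then show "t \<in> {0..1} \<and> curve_length \<gamma> 0 t = ennreal s"
          using curve_length_geodesic[OF \<gamma> sL(1)] sL unfolding L_def[symmetric] by simp
      qed
      then have "arclength_param \<gamma> s = \<gamma> (s / L)" by (simp add: arclength_param_def)
      moreover have "0 \<le> s / L" "s / L \<le> 1" using s L by auto
      ultimately show ?thesis by (simp add: \<eta>_def)
    qed
    have "curve_integral \<gamma> g = (\<integral>\<^sup>+s. g (\<eta> (s / L)) * indicator {0..L} s \<partial>lborel)"
      unfolding curve_integral_def len(2)
      by (intro nn_integral_cong) (auto simp: arc split: split_indicator)
    also have "\<dots> = ennreal L * (\<integral>\<^sup>+t. g (\<eta> ((0 + L * t) / L)) * indicator {0..L} (0 + L * t) \<partial>lborel)"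
      using L by (subst nn_integral_real_affine[where c = L and t = 0]) auto
    also have "(\<integral>\<^sup>+t. g (\<eta> ((0 + L * t) / L)) * indicator {0..L} (0 + L * t) \<partial>lborel)
        = (\<integral>\<^sup>+t\<in>{0..1}. g (\<gamma> t) \<partial>lborel)"
      using L by (intro nn_integral_cong) (auto simp: \<eta>_def zero_le_mult_iff split: split_indicator)
    finally show ?thesis by (simp add: L_def)
  qed
qed

text \<open>Admissible functions with integrals below e 2^-(k+1) are summed; each contributes at
  least 1 along every curve of the family. For geodesics the explicit curve integral commutes with
  the sum, because composition with a continuous curve stays measurable.\<close>

lemma modulus1_eq_0D:
  fixes m :: "'a::metric_space measure"
  assumes mod: "modulus1 m \<Gamma> = 0" and m: "sets m = sets borel" and e: "0 < e"
  obtains \<rho> where "\<rho> \<in> borel_measurable borel" "(\<integral>\<^sup>+x. \<rho> x \<partial>m) \<le> ennreal e"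
    "\<And>\<gamma> x y. \<gamma> \<in> \<Gamma> \<Longrightarrow> geodesic \<gamma> x y \<Longrightarrow> curve_integral \<gamma> \<rho> = \<infinity>"
proof -
  have "\<exists>\<rho>\<in>borel_measurable borel. (\<forall>\<gamma>\<in>\<Gamma>. 1 \<le> curve_integral \<gamma> \<rho>) \<and> (\<integral>\<^sup>+x. \<rho> x \<partial>m) < ennreal (e * (1/2)^Suc k)" for k
  proof -
    have "modulus1 m \<Gamma> < ennreal (e * (1/2)^Suc k)" using e mod by simp
    then show ?thesis unfolding modulus1_def INF_less_iff by auto
  qed
  then obtain r where r [measurable]: "\<And>k. r k \<in> borel_measurable borel"
    and r1: "\<And>k \<gamma>. \<gamma> \<in> \<Gamma> \<Longrightarrow> 1 \<le> curve_integral \<gamma> (r k)"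
    and r2: "\<And>k. (\<integral>\<^sup>+x. r k x \<partial>m) < ennreal (e * (1/2)^Suc k)"
    by metis
  show thesis
  proof (rule that[of "\<lambda>x. \<Sum>k. r k x"])
    show "(\<lambda>x. \<Sum>k. r k x) \<in> borel_measurable borel" by measurable
    have "(\<integral>\<^sup>+x. (\<Sum>k. r k x) \<partial>m) = (\<Sum>k. \<integral>\<^sup>+x. r k x \<partial>m)"
      by (rule nn_integral_suminf) (use r m in \<open>simp cong: measurable_cong_sets\<close>)
    also have "\<dots> \<le> (\<Sum>k. ennreal (e * (1/2)^Suc k))"
      using r2 by (intro suminf_le less_imp_le) auto
    also have "\<dots> = ennreal e"
      using sums_mult[OF power_half_series, of e] e by (intro suminf_ennreal_eq) auto
    finally show "(\<integral>\<^sup>+x. (\<Sum>k. r k x) \<partial>m) \<le> ennreal e" .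
    fix \<gamma> and x y :: 'a assume \<gamma>: "\<gamma> \<in> \<Gamma>" and geo: "geodesic \<gamma> x y"
    have \<gamma>_meas: "(\<lambda>t. r k (\<gamma> t) * indicator {0..1} t) \<in> borel_measurable lborel" for k
    proof -
      have "\<gamma> \<in> borel_measurable (restrict_space borel {0..1})"
        by (rule borel_measurable_continuous_on_restrict[OF continuous_on_geodesic[OF geo]])
      from measurable_compose[OF this r] show ?thesis
        by (simp add: borel_measurable_restrict_space_iff_ennreal mult.commute)
    qed
    have "(\<integral>\<^sup>+t\<in>{0..1}. (\<Sum>k. r k (\<gamma> t)) \<partial>lborel) = (\<integral>\<^sup>+t. (\<Sum>k. r k (\<gamma> t) * indicator {0..1} t) \<partial>lborel)"
      by (simp add: ennreal_suminf_multc)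
    also have "\<dots> = (\<Sum>k. \<integral>\<^sup>+t\<in>{0..1}. r k (\<gamma> t) \<partial>lborel)"
      by (rule nn_integral_suminf[OF \<gamma>_meas])
    finally have "curve_integral \<gamma> (\<lambda>x. \<Sum>k. r k x) = (\<Sum>k. curve_integral \<gamma> (r k))"
      by (simp add: curve_integral_geodesic[OF geo] ennreal_suminf_cmult)
    moreover have "of_nat N \<le> (\<Sum>k. curve_integral \<gamma> (r k))" for N
    proof -
      have "of_nat N \<le> (\<Sum>k<N. curve_integral \<gamma> (r k))"
        using sum_mono[of "{..<N}" "\<lambda>_. 1" "\<lambda>k. curve_integral \<gamma> (r k)"] r1[OF \<gamma>] by simp
      also have "\<dots> \<le> (\<Sum>k. curve_integral \<gamma> (r k))" by (rule sum_le_suminf) auto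
      finally show ?thesis .
    qed
    ultimately have "\<not> curve_integral \<gamma> (\<lambda>x. \<Sum>k. r k x) < \<top>"
      using ennreal_Ex_less_of_nat[of "curve_integral \<gamma> (\<lambda>x. \<Sum>k. r k x)"] by (auto simp: not_less[symmetric])
    then show "curve_integral \<gamma> (\<lambda>x. \<Sum>k. r k x) = \<infinity>" by (metis infinity_ennreal_def less_top)
  qed
qed

text \<open>The added function has total integral at most \<open>e\<close>, so the same error serves
  all sets \<open>B\<close>. In exchange the bound holds along every geodesic, exceptional or
  not.\<close>

lemma upper_gradient_geodesic:
  fixes m :: "'a::metric_space measure"
  assumes wug: "weak_upper_gradient m u g" and m: "sets m = sets borel" and e: "0 < e"
  obtains G where "G \<in> borel_measurable borel"
    "\<And>B. B \<in> sets borel \<Longrightarrow> (\<integral>\<^sup>+x\<in>B. G x \<partial>m) \<le> (\<integral>\<^sup>+x\<in>B. g x \<partial>m) + ennreal e"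
    "\<And>\<gamma> x y. geodesic \<gamma> x y \<Longrightarrow>
      ennreal \<bar>u x - u y\<bar> \<le> ennreal (dist x y) * (\<integral>\<^sup>+t\<in>{0..1}. G (\<gamma> t) \<partial>lborel)"
proof -
  have g [measurable]: "g \<in> borel_measurable borel"
    using wug by (simp add: weak_upper_gradient_def)
  let ?\<Gamma> = "{\<gamma>. rectifiable \<gamma> \<and> \<not> ennreal \<bar>u (\<gamma> 0) - u (\<gamma> 1)\<bar> \<le> curve_integral \<gamma> g}"
  have "modulus1 m ?\<Gamma> = 0"
    using wug by (simp add: weak_upper_gradient_def)
  from modulus1_eq_0D[OF this m e] obtain \<rho> where \<rho> [measurable]: "\<rho> \<in> borel_measurable borel"
    and \<rho>e: "(\<integral>\<^sup>+x. \<rho> x \<partial>m) \<le> ennreal e"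
    and \<rho>\<Gamma>: "\<And>\<gamma> x y. \<gamma> \<in> ?\<Gamma> \<Longrightarrow> geodesic \<gamma> x y \<Longrightarrow> curve_integral \<gamma> \<rho> = \<infinity>"
    by blast
  show thesis
  proof (rule that[of "\<lambda>x. g x + \<rho> x"])
    show "(\<lambda>x. g x + \<rho> x) \<in> borel_measurable borel" by measurable
    fix B :: "'a set" assume B [measurable]: "B \<in> sets borel"
    note m [measurable_cong]
    have "(\<integral>\<^sup>+x\<in>B. (g x + \<rho> x) \<partial>m) = (\<integral>\<^sup>+x\<in>B. g x \<partial>m) + (\<integral>\<^sup>+x\<in>B. \<rho> x \<partial>m)"
      by (subst nn_integral_add[symmetric]) (auto simp: distrib_right)
    also have "(\<integral>\<^sup>+x\<in>B. \<rho> x \<partial>m) \<le> (\<integral>\<^sup>+x. \<rho> x \<partial>m)"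
      by (intro nn_integral_mono) (auto split: split_indicator)
    also note \<rho>e
    finally show "(\<integral>\<^sup>+x\<in>B. (g x + \<rho> x) \<partial>m) \<le> (\<integral>\<^sup>+x\<in>B. g x \<partial>m) + ennreal e"
      by (simp add: add_left_mono)
  next
    fix \<gamma> and x y :: 'a assume \<gamma>: "geodesic \<gamma> x y"
    have mono: "curve_integral \<gamma> f \<le> curve_integral \<gamma> (\<lambda>x. g x + \<rho> x)" if "\<And>x. f x \<le> g x + \<rho> x" for f
      unfolding curve_integral_def by (intro nn_integral_mono mult_right_mono that) simp
    have "ennreal \<bar>u (\<gamma> 0) - u (\<gamma> 1)\<bar> \<le> curve_integral \<gamma> (\<lambda>x. g x + \<rho> x)"
    proof (cases "\<gamma> \<in> ?\<Gamma>")
      case True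
      then show ?thesis using \<rho>\<Gamma>[OF True \<gamma>] mono[of \<rho>] by (simp add: top_unique)
    next
      case False
      then have "ennreal \<bar>u (\<gamma> 0) - u (\<gamma> 1)\<bar> \<le> curve_integral \<gamma> g"
        using rectifiable_geodesic[OF \<gamma>] by simp
      also have "\<dots> \<le> curve_integral \<gamma> (\<lambda>x. g x + \<rho> x)" by (rule mono) simp
      finally show ?thesis .
    qed
    then show "ennreal \<bar>u x - u y\<bar>
        \<le> ennreal (dist x y) * (\<integral>\<^sup>+t\<in>{0..1}. (g (\<gamma> t) + \<rho> (\<gamma> t)) \<partial>lborel)"
      using geodesicD(1,2)[OF \<gamma>] by (simp add: curve_integral_geodesic[OF \<gamma>])
  qed
qed

section \<open>The Poincare inequality\<close>

text \<open>Averaging the triangle inequalities through \<open>y\<close> and through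
  \<open>z\<close> removes \<open>t\<close> and bounds the distance to \<open>x\<close> by half of r
  + r + 2r. This is the origin of the dilation factor 2 in the Poincare inequality.\<close>

lemma midpoint_region:
  assumes \<gamma>: "geodesic \<gamma> y z" and y: "y \<in> ball x r" and z: "z \<in> ball x r" and t: "t \<in> {0..1}"
  shows "\<gamma> t \<in> ball x (2 * r)"
proof -
  have yz: "dist y z \<le> 2 * r"
    using dist_triangle3[of y z x] y z by simp
  have "dist x (\<gamma> t) \<le> dist x y + t * dist y z" "dist x (\<gamma> t) \<le> dist x z + (1 - t) * dist y z"
    using dist_triangle[of x "\<gamma> t" y] dist_triangle[of x "\<gamma> t" z] geodesicD(4,5)[OF \<gamma> t]
    by (auto simp: dist_commute)
  then have "2 * dist x (\<gamma> t) \<le> dist x y + dist x z + dist y z" by (simp add: algebra_simps)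
  then show ?thesis using y z yz by simp
qed

context concave_hausdorff
begin

lemma sets_prolongable_pairs [measurable]: "(prolongable_pairs :: ('a \<times> 'a) set) \<in> sets (borel \<Otimes>\<^sub>M borel)"
  using prolongable_pairs_borel[OF proper] sets_borel_pair_of_proper(1)[OF proper] by simp

lemma measurable_geod_compose [measurable (raw)]:
  fixes f g :: "'b \<Rightarrow> 'a" and h :: "'b \<Rightarrow> real"
  assumes "f \<in> borel_measurable M" "g \<in> borel_measurable M" "h \<in> borel_measurable M"
  shows "(\<lambda>w. geod (f w) (g w) (h w)) \<in> borel_measurable M"
proof -
  have "(\<lambda>w. ((f w, g w), h w)) \<in> M \<rightarrow>\<^sub>M (borel \<Otimes>\<^sub>M borel) \<Otimes>\<^sub>M borel"
    using assms by (intro measurable_Pair)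
  from measurable_compose[OF this measurable_geod[OF proper busemann]] show ?thesis by simp
qed

text \<open>The contraction estimate says that 2^-n times the image under \<open>h\<close> of the
  measure on \<open>A\<close> is at most the measure on \<open>B\<close>; this is then integrated
  against \<open>G\<close>. The bound \<open>1 / 2 \<le> t\<close> makes the constant uniform in
  \<open>t\<close>.\<close>

lemma nn_integral_contraction:
  assumes t: "1 / 2 \<le> t" "t \<le> 1"
    and A [measurable]: "A \<in> sets borel" and B [measurable]: "B \<in> sets borel"
    and h [measurable]: "h \<in> borel_measurable borel" and G [measurable]: "G \<in> borel_measurable borel"
    and ex: "\<And>a. a \<in> A \<Longrightarrow> \<exists>\<gamma>. geodesic \<gamma> x a \<and> \<gamma> t = h a" and sub: "\<And>a. a \<in> A \<Longrightarrow> h a \<in> B"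
  shows "(\<integral>\<^sup>+a\<in>A. G (h a) \<partial>m) \<le> ennreal (2 powr n) * (\<integral>\<^sup>+y\<in>B. G y \<partial>m)"
proof -
  let ?N = "distr (density m (indicator A)) borel h"
  let ?M = "density m (indicator B)"
  have half: "(2 powr n) * rpow (1 / 2) n = 1"
    using powr_mult[of 2 "1 / 2" n] by (simp add: rpow_def)
  have "scale_measure (ennreal (rpow (1 / 2) n)) ?N \<le> ?M"
  proof (subst le_measure)
    show "\<forall>E\<in>sets (scale_measure (ennreal (rpow (1 / 2) n)) ?N).
        emeasure (scale_measure (ennreal (rpow (1 / 2) n)) ?N) E \<le> emeasure ?M E"
    proof
      fix E assume "E \<in> sets (scale_measure (ennreal (rpow (1 / 2) n)) ?N)"
      then have E [measurable]: "E \<in> sets borel" by simp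
      have hE [measurable]: "h -` E \<in> sets borel" using measurable_sets[OF h E] by simp
      have "ennreal (rpow (1 / 2) n) * emeasure ?N E = ennreal (rpow (1 / 2) n) * emeasure m (A \<inter> h -` E)"
        by (simp add: emeasure_distr emeasure_restricted)
      also have "\<dots> \<le> ennreal (rpow t n) * emeasure m (A \<inter> h -` E)"
        using rpow_mono[OF n, of "1 / 2" t] t by (intro mult_right_mono ennreal_leI) auto
      also have "\<dots> \<le> emeasure m (B \<inter> E)"
      proof (rule contraction)
        fix a assume "a \<in> A \<inter> h -` E"
        then show "\<exists>\<gamma>. geodesic \<gamma> x a \<and> \<gamma> t \<in> B \<inter> E" using ex[of a] sub[of a] by auto
      qed (use t hE in auto)
      also have "\<dots> = emeasure ?M E"
        by (simp add: emeasure_restricted)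
      finally show "emeasure (scale_measure (ennreal (rpow (1 / 2) n)) ?N) E \<le> emeasure ?M E" by simp
    qed
  qed simp
  then have "(\<integral>\<^sup>+y. G y \<partial>scale_measure (ennreal (rpow (1 / 2) n)) ?N) \<le> (\<integral>\<^sup>+y. G y \<partial>?M)"
    by (intro nn_integral_mono_measure) auto
  then have "ennreal (rpow (1 / 2) n) * (\<integral>\<^sup>+a\<in>A. G (h a) \<partial>m) \<le> (\<integral>\<^sup>+y\<in>B. G y \<partial>m)"
    by (simp add: nn_integral_scale_measure nn_integral_distr nn_integral_density mult.commute)
  from mult_left_mono[OF this, of "ennreal (2 powr n)"]
  show ?thesis
    by (simp add: mult.assoc[symmetric] ennreal_mult[symmetric] half rpow_nonneg)
qed

text \<open>Tonelli's theorem moves the time integral outside, so that for each time one may decide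
  which endpoint stays fixed. The other endpoint is transported, and integrating over the fixed one
  yields the factor \<open>emeasure m (ball x r)\<close>.\<close>

lemma nn_integral_geod_le:
  assumes [measurable]: "G \<in> borel_measurable borel"
  shows "(\<integral>\<^sup>+y\<in>ball x r. (\<integral>\<^sup>+z\<in>ball x r. (indicator prolongable_pairs (y, z) *
        (\<integral>\<^sup>+t\<in>{0..1}. G (geod y z t) \<partial>lborel)) \<partial>m) \<partial>m)
      \<le> ennreal (2 powr n) * emeasure m (ball x r) * (\<integral>\<^sup>+y\<in>ball x (2 * r). G y \<partial>m)"
proof -
  define B where "B = ball x r"
  have B [measurable]: "B \<in> sets borel" by (simp add: B_def)
  interpret m: sigma_finite_measure m by (rule sigma_finite)
  interpret mm: pair_sigma_finite m m ..
  interpret mt: pair_sigma_finite "m \<Otimes>\<^sub>M m" lborel ..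
  define F :: "('a \<times> 'a) \<times> real \<Rightarrow> ennreal" where
    "F = (\<lambda>((y, z), t). indicator (B) y * indicator (B) z *
      indicator prolongable_pairs (y, z) * indicator {0..1} t * G (geod y z t))"
  let ?J = "\<integral>\<^sup>+y\<in>ball x (2 * r). G y \<partial>m"
  let ?W = "prolongable_pairs :: ('a \<times> 'a) set"
  have F [measurable]: "F \<in> borel_measurable ((borel \<Otimes>\<^sub>M borel) \<Otimes>\<^sub>M borel)"
    unfolding F_def split_beta by measurable
  have F' [measurable]: "F \<in> borel_measurable ((m \<Otimes>\<^sub>M m) \<Otimes>\<^sub>M lborel)"
    by measurable
  have slice: "(\<integral>\<^sup>+q. F (q, t) \<partial>(m \<Otimes>\<^sub>M m)) \<le> indicator {0..1} t * (ennreal (2 powr n) * emeasure m (B) * ?J)" for t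
  proof (cases "t \<in> {0..1}")
    case False
    then show ?thesis by (simp add: F_def split_beta)
  next
    case t: True
    have Ft [measurable]: "(\<lambda>q. F (q, t)) \<in> borel_measurable (m \<Otimes>\<^sub>M m)" by measurable
    have const: "(\<integral>\<^sup>+y. indicator (B) y * (ennreal (2 powr n) * ?J) \<partial>m)
        = ennreal (2 powr n) * emeasure m (B) * ?J"
      by (subst nn_integral_multc) (auto simp: mult_ac)
    show ?thesis
    proof (cases "1 / 2 \<le> t")
      case True
      have "(\<integral>\<^sup>+z. F ((y, z), t) \<partial>m) \<le> indicator (B) y * (ennreal (2 powr n) * ?J)" for y
      proof (cases "y \<in> B")
        case y: True
        let ?A = "B \<inter> {z. (y, z) \<in> ?W}"
        have "(\<integral>\<^sup>+z. F ((y, z), t) \<partial>m) = (\<integral>\<^sup>+z\<in>?A. G (geod y z t) \<partial>m)"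
          using y t by (intro nn_integral_cong) (auto simp: F_def split: split_indicator)
        also have "\<dots> \<le> ennreal (2 powr n) * ?J"
        proof (rule nn_integral_contraction[where x = y and t = t])
          show "?A \<in> sets borel" using section_prolongable_borel[of y] by auto
          show "(\<lambda>z. geod y z t) \<in> borel_measurable borel" by measurable
          fix z assume z: "z \<in> ?A"
          then have g: "geodesic (geod y z) y z" by (intro geodesic_geod[OF geodesic_space]) auto
          then show "\<exists>\<gamma>. geodesic \<gamma> y z \<and> \<gamma> t = geod y z t" by blast
          show "geod y z t \<in> ball x (2 * r)"
            by (rule midpoint_region[OF g _ _ t]) (use y z in \<open>auto simp: B_def\<close>)
        qed (use True t in auto)
        finally show ?thesis using y by simp
      qed (simp add: F_def)
      then have "(\<integral>\<^sup>+y. \<integral>\<^sup>+z. F ((y, z), t) \<partial>m \<partial>m) \<le> (\<integral>\<^sup>+y. indicator (B) y * (ennreal (2 powr n) * ?J) \<partial>m)"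
        by (intro nn_integral_mono) auto
      then show ?thesis
        using m.nn_integral_fst[OF Ft] t unfolding const by simp
    next
      case False
      have "(\<integral>\<^sup>+y. F ((y, z), t) \<partial>m) \<le> indicator (B) z * (ennreal (2 powr n) * ?J)" for z
      proof (cases "z \<in> B")
        case z: True
        let ?A = "B \<inter> {y. (y, z) \<in> ?W}"
        have "(\<integral>\<^sup>+y. F ((y, z), t) \<partial>m) = (\<integral>\<^sup>+y\<in>?A. G (geod y z t) \<partial>m)"
          using z t by (intro nn_integral_cong) (auto simp: F_def split: split_indicator)
        also have "\<dots> \<le> ennreal (2 powr n) * ?J"
        \<comment> \<open>Read backwards from \<open>z\<close>, the geodesic reaches the same point
          at time \<open>1 - t\<close>, which exceeds 1/2.\<close>
        proof (rule nn_integral_contraction[where x = z and t = "1 - t"])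
          have "{y \<in> space borel. (y, z) \<in> ?W} \<in> sets borel" by measurable
          then show "?A \<in> sets borel" by auto
          show "(\<lambda>y. geod y z t) \<in> borel_measurable borel" by measurable
          fix y assume y: "y \<in> ?A"
          then have g: "geodesic (geod y z) y z" by (intro geodesic_geod[OF geodesic_space]) auto
          show "\<exists>\<gamma>. geodesic \<gamma> z y \<and> \<gamma> (1 - t) = geod y z t"
            using geodesic_reverse[OF g] by (intro exI[of _ "\<lambda>s. geod y z (1 - s)"]) simp
          show "geod y z t \<in> ball x (2 * r)"
            by (rule midpoint_region[OF g _ _ t]) (use y z in \<open>auto simp: B_def\<close>)
        qed (use False t in auto)
        finally show ?thesis using z by simp
      qed (simp add: F_def)
      then have "(\<integral>\<^sup>+z. \<integral>\<^sup>+y. F ((y, z), t) \<partial>m \<partial>m) \<le> (\<integral>\<^sup>+z. indicator (B) z * (ennreal (2 powr n) * ?J) \<partial>m)"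
        by (intro nn_integral_mono) auto
      then show ?thesis
        using mm.nn_integral_snd[OF Ft] t unfolding const by simp
    qed
  qed
  have "(\<integral>\<^sup>+y\<in>B. (\<integral>\<^sup>+z\<in>B. (indicator ?W (y, z) *
        (\<integral>\<^sup>+t\<in>{0..1}. G (geod y z t) \<partial>lborel)) \<partial>m) \<partial>m) = (\<integral>\<^sup>+y. \<integral>\<^sup>+z. \<integral>\<^sup>+t. F ((y, z), t) \<partial>lborel \<partial>m \<partial>m)"
  proof (intro nn_integral_cong)
    fix y
    have "(\<integral>\<^sup>+z. \<integral>\<^sup>+t. F ((y, z), t) \<partial>lborel \<partial>m)
        = (\<integral>\<^sup>+z. indicator (B) y * ((indicator ?W (y, z) *
          (\<integral>\<^sup>+t\<in>{0..1}. G (geod y z t) \<partial>lborel)) * indicator (B) z) \<partial>m)"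
      by (intro nn_integral_cong)
        (auto simp: F_def mult_ac split: split_indicator)
    also have "\<dots> = (\<integral>\<^sup>+z\<in>B. (indicator ?W (y, z) *
        (\<integral>\<^sup>+t\<in>{0..1}. G (geod y z t) \<partial>lborel)) \<partial>m) * indicator (B) y"
      by (auto split: split_indicator)
    finally show "(\<integral>\<^sup>+z\<in>B. (indicator ?W (y, z) *
        (\<integral>\<^sup>+t\<in>{0..1}. G (geod y z t) \<partial>lborel)) \<partial>m) * indicator (B) y
        = (\<integral>\<^sup>+z. \<integral>\<^sup>+t. F ((y, z), t) \<partial>lborel \<partial>m)" by simp
  qed
  also have "\<dots> = (\<integral>\<^sup>+q. \<integral>\<^sup>+t. F (q, t) \<partial>lborel \<partial>(m \<Otimes>\<^sub>M m))"
    by (rule m.nn_integral_fst) measurable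
  also have "\<dots> = (\<integral>\<^sup>+t. \<integral>\<^sup>+q. F (q, t) \<partial>(m \<Otimes>\<^sub>M m) \<partial>lborel)"
    by (rule mt.Fubini[OF F', symmetric])
  also have "\<dots> \<le> (\<integral>\<^sup>+t. indicator {0..1::real} t * (ennreal (2 powr n) * emeasure m (B) * ?J) \<partial>lborel)"
    by (intro nn_integral_mono slice)
  also have "\<dots> = ennreal (2 powr n) * emeasure m (B) * ?J"
    by (subst nn_integral_multc) auto
  finally show ?thesis unfolding B_def .
qed

text \<open>The closed ball is compact by properness, so finitely many balls of local integrability
  cover it.\<close>

lemma set_integrable_ball:
  fixes u :: "'a \<Rightarrow> real"
  assumes "locally_integrable (completion m) u"
  shows "set_integrable (completion m) (ball x r) u"
proof -
  obtain \<epsilon> where \<epsilon>: "\<And>y. 0 < \<epsilon> y" "\<And>y. set_integrable (completion m) (ball y (\<epsilon> y)) u"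
    using assms unfolding locally_integrable_def by metis
  have "compact (cball x r)" using proper by (simp add: proper_space_def)
  moreover have "cball x r \<subseteq> (\<Union>y\<in>cball x r. ball y (\<epsilon> y))" using \<epsilon>(1) by force
  ultimately obtain I where I: "finite I" "cball x r \<subseteq> (\<Union>y\<in>I. ball y (\<epsilon> y))"
    using compactE_image[of "cball x r" "cball x r" "\<lambda>y. ball y (\<epsilon> y)"] by (metis open_ball)
  have "set_integrable (completion m) (\<Union>y\<in>I. ball y (\<epsilon> y)) u"
    by (rule set_integrable_UN[OF I(1) \<epsilon>(2)]) auto
  then show ?thesis
    by (rule set_integrable_subset) (use I(2) ball_subset_cball[of x r] in auto)
qed

lemma poincare_ball:
  fixes u :: "'a \<Rightarrow> real"
  assumes u: "locally_integrable (completion m) u" and wug: "weak_upper_gradient m u g" and r: "0 < r"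
    and e: "0 < e"
  shows "(\<integral>\<^sup>+y\<in>ball x r. ennreal \<bar>u y - average (completion m) (ball x r) u\<bar> \<partial>completion m)
    \<le> ennreal (2 * r * 2 powr n) * ((\<integral>\<^sup>+y\<in>ball x (2 * r). g y \<partial>m) + ennreal e)"
proof -
  interpret m: sigma_finite_measure m by (rule sigma_finite)
  define B where "B = ball x r"
  have B [measurable]: "B \<in> sets borel" by (simp add: B_def)
  define V where "V = measure m B"
  have Vm: "emeasure m B = ennreal V"
    using emeasure_ball_less_top[of x r] by (simp add: V_def B_def emeasure_eq_ennreal_measure less_top)
  have V: "0 < V" using emeasure_ball_pos[OF r, of x] Vm by (simp add: B_def)
  obtain G where G [measurable]: "G \<in> borel_measurable borel"
    and Gg: "\<And>B. B \<in> sets borel \<Longrightarrow> (\<integral>\<^sup>+x\<in>B. G x \<partial>m) \<le> (\<integral>\<^sup>+x\<in>B. g x \<partial>m) + ennreal e"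
    and Gu: "\<And>\<gamma> x y. geodesic \<gamma> x y \<Longrightarrow>
      ennreal \<bar>u x - u y\<bar> \<le> ennreal (dist x y) * (\<integral>\<^sup>+t\<in>{0..1}. G (\<gamma> t) \<partial>lborel)"
    using upper_gradient_geodesic[OF wug _ e] by auto
  have "u \<in> borel_measurable (completion m)" using u by (simp add: locally_integrable_def)
  \<comment> \<open>Tonelli's theorem needs a Borel function, but \<open>u\<close> is only
    measurable for the completion. The gradient bound concerns the pointwise values of
    \<open>u\<close>, so it passes to \<open>v\<close> only almost everywhere.\<close>
  then obtain v where v: "v \<in> borel_measurable m" and uv: "AE y in m. u y = v y"
    using completion_ex_borel_measurable_real by blast
  have v' [measurable]: "v \<in> borel_measurable borel" using v by (simp cong: measurable_cong_sets)
  have uvB: "AE y in completion m. indicator B y *\<^sub>R u y = indicator B y *\<^sub>R v y"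
    using AE_completion[OF uv] by (rule eventually_mono) simp
  have iv: "integrable m (\<lambda>y. indicator B y *\<^sub>R v y)"
  proof -
    have "integrable (completion m) (\<lambda>y. indicator B y *\<^sub>R u y)"
      using set_integrable_ball[OF u, of x r] by (simp add: set_integrable_def B_def)
    then have "integrable (completion m) (\<lambda>y. indicator B y *\<^sub>R v y)"
      by (rule integrable_cong_AE_imp) (use uvB in \<open>auto intro!: measurable_completion elim: eventually_mono\<close>)
    then show ?thesis by (subst (asm) integrable_completion) auto
  qed
  define a where "a = average (completion m) B u"
  have a: "a = (\<integral>y. indicator B y *\<^sub>R v y \<partial>m) / V"
  proof -
    have "(\<integral>y. indicator B y *\<^sub>R u y \<partial>completion m) = (\<integral>y. indicator B y *\<^sub>R v y \<partial>completion m)"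
    proof (rule integral_cong_AE)
      show "(\<lambda>y. indicator B y *\<^sub>R u y) \<in> borel_measurable (completion m)"
        using set_integrable_ball[OF u, of x r] unfolding set_integrable_def B_def by (rule borel_measurable_integrable)
    qed (use uvB in \<open>auto intro!: measurable_completion\<close>)
    also have "\<dots> = (\<integral>y. indicator B y *\<^sub>R v y \<partial>m)" by (rule integral_completion) measurable
    finally show ?thesis by (simp add: a_def average_def set_lebesgue_integral_def V_def)
  qed
  \<comment> \<open>Since \<open>a\<close> is also the mean of \<open>v\<close> over
    \<open>B\<close>, the integral of \<open>v y - v z\<close> over z in \<open>B\<close> is
    \<open>V * (v y - a)\<close>.\<close>
  have mean: "ennreal V * ennreal \<bar>v y - a\<bar> \<le> (\<integral>\<^sup>+z\<in>B. ennreal \<bar>v y - v z\<bar> \<partial>m)" for y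
  proof -
    have i1: "integrable m (\<lambda>z. indicator B z *\<^sub>R v y)"
      using emeasure_ball_less_top[of x r] unfolding B_def
      by (intro integrable_scaleR_left integrable_real_indicator) auto
    then have i: "integrable m (\<lambda>z. indicator B z *\<^sub>R v y - indicator B z *\<^sub>R v z)"
      using iv by (rule Bochner_Integration.integrable_diff)
    have "(\<integral>z. indicator B z *\<^sub>R v y - indicator B z *\<^sub>R v z \<partial>m) = V * v y - V * a"
      using i1 iv V by (subst Bochner_Integration.integral_diff) (auto simp: a V_def)
    then have "ennreal V * ennreal \<bar>v y - a\<bar>
        = ennreal (norm (\<integral>z. indicator B z *\<^sub>R v y - indicator B z *\<^sub>R v z \<partial>m))"
      using V by (simp add: ennreal_mult[symmetric] abs_mult right_diff_distrib[symmetric])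
    also have "\<dots> \<le> (\<integral>\<^sup>+z. norm (indicator B z *\<^sub>R v y - indicator B z *\<^sub>R v z) \<partial>m)"
      by (rule integral_norm_bound_ennreal[OF i])
    also have "\<dots> = (\<integral>\<^sup>+z\<in>B. ennreal \<bar>v y - v z\<bar> \<partial>m)"
      by (intro nn_integral_cong) (auto split: split_indicator)
    finally show ?thesis .
  qed
  let ?K = "\<lambda>y z. indicator prolongable_pairs (y, z) * (\<integral>\<^sup>+t\<in>{0..1}. G (geod y z t) \<partial>lborel)"
  have pointwise: "ennreal \<bar>u y - u z\<bar> \<le> ennreal (2 * r) * ?K y z"
    if yz: "y \<in> B" "z \<in> B" "(y, z) \<in> prolongable_pairs" for y z
  proof -
    have "dist y z \<le> 2 * r" using dist_triangle3[of y z x] yz by (simp add: B_def)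
    then have "ennreal (dist y z) * (\<integral>\<^sup>+t\<in>{0..1}. G (geod y z t) \<partial>lborel)
        \<le> ennreal (2 * r) * (\<integral>\<^sup>+t\<in>{0..1}. G (geod y z t) \<partial>lborel)"
      by (intro mult_right_mono ennreal_leI) auto
    with Gu[OF geodesic_geod[OF geodesic_space yz(3)]]
    have "ennreal \<bar>u y - u z\<bar> \<le> ennreal (2 * r) * (\<integral>\<^sup>+t\<in>{0..1}. G (geod y z t) \<partial>lborel)"
      by (rule order_trans)
    then show ?thesis using yz(3) by (simp only: indicator_simps mult_1)
  qed
  \<comment> \<open>The exceptional set of \<open>z\<close> may depend on \<open>y\<close>: for
    almost every \<open>y\<close>, and then for almost every \<open>z\<close>, both values of
    \<open>u\<close> agree with those of \<open>v\<close> and the pair is prolongable.\<close>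
  have inner: "AE y in m. (\<integral>\<^sup>+z\<in>B. ennreal \<bar>v y - v z\<bar> \<partial>m) * indicator B y
      \<le> ennreal (2 * r) * ((\<integral>\<^sup>+z\<in>B. ?K y z \<partial>m) * indicator B y)"
    using uv
  proof eventually_elim
    case (elim y)
    show ?case
    proof (cases "y \<in> B")
      case y: True
      have "(\<integral>\<^sup>+z\<in>B. ennreal \<bar>v y - v z\<bar> \<partial>m) \<le> (\<integral>\<^sup>+z. ennreal (2 * r) * (?K y z * indicator B z) \<partial>m)"
      proof (rule nn_integral_mono_AE)
        show "AE z in m. ennreal \<bar>v y - v z\<bar> * indicator B z \<le> ennreal (2 * r) * (?K y z * indicator B z)"
          using uv AE_prolongable[of y]
        proof eventually_elim
          case (elim z)
          show ?case
            using pointwise[OF y _ elim(2)] elim(1) \<open>u y = v y\<close> by (auto split: split_indicator)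
        qed
      qed
      also have "\<dots> = ennreal (2 * r) * (\<integral>\<^sup>+z\<in>B. ?K y z \<partial>m)"
        by (rule nn_integral_cmult) measurable
      finally show ?thesis using y by simp
    qed simp
  qed
  have "ennreal V * (\<integral>\<^sup>+y\<in>B. ennreal \<bar>v y - a\<bar> \<partial>m) = (\<integral>\<^sup>+y. (ennreal V * ennreal \<bar>v y - a\<bar>) * indicator B y \<partial>m)"
    by (subst nn_integral_cmult[symmetric]) (auto simp: mult.assoc)
  also have "\<dots> \<le> (\<integral>\<^sup>+y. (\<integral>\<^sup>+z\<in>B. ennreal \<bar>v y - v z\<bar> \<partial>m) * indicator B y \<partial>m)"
    by (intro nn_integral_mono mult_right_mono mean) simp
  also have "\<dots> \<le> (\<integral>\<^sup>+y. ennreal (2 * r) * ((\<integral>\<^sup>+z\<in>B. ?K y z \<partial>m) * indicator B y) \<partial>m)"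
    by (rule nn_integral_mono_AE[OF inner])
  also have "\<dots> = ennreal (2 * r) * (\<integral>\<^sup>+y\<in>B. (\<integral>\<^sup>+z\<in>B. ?K y z \<partial>m) \<partial>m)"
    by (rule nn_integral_cmult) measurable
  also have "\<dots> \<le> ennreal (2 * r) * (ennreal (2 powr n) * ennreal V * (\<integral>\<^sup>+y\<in>ball x (2 * r). G y \<partial>m))"
    using nn_integral_geod_le[OF G, of x r] unfolding B_def[symmetric] Vm by (rule mult_left_mono) simp
  also have "\<dots> = ennreal V * (ennreal (2 * r * 2 powr n) * (\<integral>\<^sup>+y\<in>ball x (2 * r). G y \<partial>m))"
    using r by (simp add: ennreal_mult mult_ac)
  finally have "(\<integral>\<^sup>+y\<in>B. ennreal \<bar>v y - a\<bar> \<partial>m) \<le> ennreal (2 * r * 2 powr n) * (\<integral>\<^sup>+y\<in>ball x (2 * r). G y \<partial>m)"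
    using V by (subst (asm) ennreal_mult_le_mult_iff) auto
  also have "\<dots> \<le> ennreal (2 * r * 2 powr n) * ((\<integral>\<^sup>+y\<in>ball x (2 * r). g y \<partial>m) + ennreal e)"
    by (intro mult_left_mono Gg) auto
  also have "(\<integral>\<^sup>+y\<in>B. ennreal \<bar>v y - a\<bar> \<partial>m) = (\<integral>\<^sup>+y\<in>B. ennreal \<bar>u y - a\<bar> \<partial>completion m)"
    unfolding nn_integral_completion
    by (rule nn_integral_cong_AE) (use uv in \<open>auto elim: eventually_mono\<close>)
  finally show ?thesis unfolding a_def B_def .
qed

lemma poincare11_m: "poincare11 m"
  unfolding poincare11_def
\<comment> \<open>The 2 comes from the distance bound 2r inside a ball, one factor 2^n from
  contraction, the other from doubling, which exchanges the volume of \<open>ball x r\<close> for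
  that of \<open>ball x (2 * r)\<close>.\<close>
proof (rule exI[of _ "2 * (2 powr n * 2 powr n)"], rule conjI, simp, rule exI[of _ 2], rule conjI, simp,
    intro allI impI, elim conjE)
  fix x :: 'a and r :: real and u :: "'a \<Rightarrow> real" and g
  assume r: "0 < r" and u: "locally_integrable (completion m) u" and g: "weak_upper_gradient m u g"
  let ?L = "\<integral>\<^sup>+y\<in>ball x r. ennreal \<bar>u y - average (completion m) (ball x r) u\<bar> \<partial>completion m"
  let ?J = "\<integral>\<^sup>+y\<in>ball x (2 * r). g y \<partial>m"
  define V W where "V = measure m (ball x r)" and "W = measure m (ball x (2 * r))"
  have Vm: "emeasure m (ball x r) = ennreal V" "emeasure m (ball x (2 * r)) = ennreal W"
    using emeasure_ball_less_top[of x r] emeasure_ball_less_top[of x "2 * r"]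
    by (simp_all add: V_def W_def emeasure_eq_ennreal_measure less_top)
  have V: "0 < V" "0 < W"
    using emeasure_ball_pos[OF r, of x] emeasure_ball_pos[of "2 * r" x] r by (simp_all add: Vm)
  have VW: "W \<le> 2 powr n * V"
    using doubling[OF r, of x] V by (simp add: Vm ennreal_mult[symmetric])
  have frac: "ennreal a * J / ennreal v = ennreal (a / v) * J" if "0 \<le> a" "0 < v" for a v J
    using that by (simp add: divide_ennreal_def inverse_ennreal divide_inverse ennreal_mult mult_ac)
  have "?L \<le> ennreal (2 * r * 2 powr n) * ?J"
  proof (rule ennreal_le_epsilon)
    fix e :: real assume e: "0 < e"
    define d where "d = 2 * r * 2 powr n"
    have d: "0 < d" using r by (simp add: d_def)
    \<comment> \<open>The error in the gradient is taken as \<open>e / d\<close>, so that after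
      multiplication by \<open>d\<close> it becomes \<open>e\<close>.\<close>
    have "?L \<le> ennreal d * (?J + ennreal (e / d))"
      using poincare_ball[OF u g r, of "e / d" x] e d by (simp add: d_def)
    also have "\<dots> = ennreal d * ?J + ennreal e"
      using d e by (simp add: distrib_left ennreal_mult[symmetric])
    finally show "?L \<le> ennreal (2 * r * 2 powr n) * ?J + ennreal e" by (simp add: d_def)
  qed
  then have "?L / ennreal V \<le> ennreal (2 * r * 2 powr n) * ?J / ennreal V"
    by (rule divide_right_mono_ennreal)
  also have "\<dots> = ennreal (2 * r * 2 powr n / V) * ?J"
    by (rule frac) (use V r in auto)
  also have "\<dots> \<le> ennreal (2 * (2 powr n * 2 powr n) * r / W) * ?J"
  proof (intro mult_right_mono ennreal_leI)
    have "2 * r * 2 powr n * W \<le> 2 * r * 2 powr n * (2 powr n * V)"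
      using VW r by (intro mult_left_mono) auto
    then show "2 * r * 2 powr n / V \<le> 2 * (2 powr n * 2 powr n) * r / W"
      using V by (simp add: divide_le_eq le_divide_eq mult_ac)
  qed simp
  also have "\<dots> = ennreal (2 * (2 powr n * 2 powr n) * r) * (?J / ennreal W)"
    unfolding ennreal_times_divide by (rule frac[symmetric]) (use V r in auto)
  finally show "?L / emeasure m (ball x r)
      \<le> ennreal (2 * (2 powr n * 2 powr n) * r) * (?J / emeasure m (ball x (2 * r)))"
    by (simp add: Vm)
qed

end

theorem proposition2p23:
  fixes n c :: real
  assumes "proper_space TYPE('a::complete_space)"
    and "geodesic_space TYPE('a)"
    and "busemann_concave TYPE('a)"
    and "0 < c" and "0 \<le> n"
    and "\<exists>(x::'a) r. 0 < r \<and> 0 < emeasure (hausdorff_measure c n) (ball x r)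
            \<and> emeasure (hausdorff_measure c n) (ball x r) < \<infinity>"
  shows "MCP0 n (hausdorff_measure c n :: 'a measure)
    \<and> BG0 n (hausdorff_measure c n :: 'a measure)
    \<and> poincare11 (hausdorff_measure c n :: 'a measure)
    \<and> (\<forall>(x::'a) r. 0 < r \<longrightarrow>
          emeasure (hausdorff_measure c n) (ball x (2 * r))
            \<le> ennreal (2 powr n) * emeasure (hausdorff_measure c n) (ball x r))"
proof -
  obtain p :: 'a and \<rho> where "0 < \<rho>" "0 < emeasure (hausdorff_measure c n) (ball p \<rho>)"
      "emeasure (hausdorff_measure c n) (ball p \<rho>) < \<infinity>"
    using assms(6) by blast
  then interpret concave_hausdorff n c p \<rho>
    using assms by unfold_locales auto
  show ?thesis
    using MCP0_m BG0_m poincare11_m doubling by blast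
qed

end
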